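(* Let $k$ be a field (of arbitrary characteristic), let $n$ be a positive integer, and let $G$ be a subgroup of $\widehat{\mathfrak{S}_n}=\mathfrak{S}_n\rtimes\{\pm1\}^n$, acting on $k_{-1}[x_1,\dots,x_n]$ and on the commutative polynomial ring $k[x_1,\dots,x_n]$ by signed permutations of the variables. Then $$d_{k_{-1}[x_1,\dots,x_n]^G}\le n^2\quad\text{and}\quad d_{k[x_1,\dots,x_n]^G}\le n^2.$$
   Context: $k_{-1}[x_1,\dots,x_n]$ is the $k$-algebra generated by $x_1,\dots,x_n$ subject to $x_ix_j=-x_jx_i$ for all $i\ne j$; both algebras are graded by $\deg x_i=1$. The symmetric group $\mathfrak{S}_n$ acts by the graded algebra automorphisms $x_i\mapsto x_{\sigma(i)}$, and $\{\pm1\}^n$ is the group of diagonal graded automorphisms $x_i\mapsto a_ix_i$ with $a_i=\pm1$. A superscript $G$ denotes the subring of elements fixed by $G$. For a connected graded algebra $B=k\oplus B_1\oplus B_2\oplus\cdots$, with $B_{\ge1}=\bigoplus_{i\ge1}B_i$, the number $d_B$ is the maximal degree of the graded vector space $B_{\ge 1}/(B_{\ge 1})^2$; thus $B$ is generated as an algebra by homogeneous elements of degree at most $d_B$.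
   Formalization: The case n = 1, char k ≠ 2, G = {±1} is excluded: there both invariant rings are k[x²], so d = 2 > 1 = n² and the claim is false; for n = 1 it is assumed that char k = 2 or G is trivial. *)

theory Defs
  imports
    "HOL-Library.Poly_Mapping"
    "HOL-Library.Extended_Nat"
    "HOL-Library.Cardinality"
    "HOL-Algebra.Group"
begin

text \<open>
  Throughout, the variables are indexed by a finite type \<open>'n\<close>, so \<open>n = CARD('n) \<ge> 1\<close>,
  and \<open>'k\<close> is the coefficient field.
\<close>

subsection \<open>Graded subalgebras and the number $d_B$\<close>

definition finite_sums :: "'a::monoid_add set \<Rightarrow> 'a set" where
  "finite_sums S = {sum_list xs | xs. set xs \<subseteq> S}"

text \<open>
  A graded algebra is given by its homogeneous components \<open>B :: nat \<Rightarrow> 'a set\<close> inside an ambient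
  ring.  These are subspaces, so finite sums suffice to form \<open>B\<^bsub>\<ge>1\<^esub>\<close> and its square.
\<close>

definition positive_part :: "(nat \<Rightarrow> 'a::ring_1 set) \<Rightarrow> 'a set" where
  "positive_part B = finite_sums (\<Union>d\<in>{1..}. B d)"

definition positive_part_square :: "(nat \<Rightarrow> 'a::ring_1 set) \<Rightarrow> 'a set" where
  "positive_part_square B =
     finite_sums {f * g | f g. f \<in> positive_part B \<and> g \<in> positive_part B}"

text \<open>
  The component of degree \<open>d \<ge> 1\<close> of the graded space \<open>B\<^bsub>\<ge>1\<^esub> / (B\<^bsub>\<ge>1\<^esub>)\<^sup>2\<close> is the image of \<open>B d\<close>, so it
  is nonzero iff \<open>B d\<close> is not contained in the square.  The maximal degree is taken in \<open>enat\<close>: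
  it is \<open>\<infinity>\<close> if infinitely many components are nonzero.
\<close>

definition max_gen_degree :: "(nat \<Rightarrow> 'a::ring_1 set) \<Rightarrow> enat" where
  "max_gen_degree B = Sup (enat ` {d. 1 \<le> d \<and> \<not> B d \<subseteq> positive_part_square B})"


subsection \<open>The group of signed permutations\<close>

text \<open>
  The pair \<open>(\<sigma>, a)\<close> stands for the automorphism \<open>x\<^sub>i \<mapsto> a\<^sub>i x\<^bsub>\<sigma>(i)\<^esub>\<close>, that is, for the diagonal
  automorphism \<open>a\<close> followed by the permutation \<open>\<sigma>\<close>; the product is composition, the right factor
  acting first.  The signs are integers because in characteristic 2 the group \<open>{\<plusminus>1}\<^sup>n\<close> is still
  taken to have order \<open>2\<^sup>n\<close> (it then acts trivially).
\<close>

definition signed_perms :: "(('n::finite \<Rightarrow> 'n) \<times> ('n \<Rightarrow> int)) monoid" where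
  "signed_perms =
     \<lparr>carrier = {(\<sigma>, a). bij \<sigma> \<and> (\<forall>i. a i \<in> {1, -1})},
      monoid.mult = (\<lambda>(\<sigma>, a) (\<tau>, b). (\<sigma> \<circ> \<tau>, \<lambda>i. a (\<tau> i) * b i)),
      one = (id, \<lambda>_. 1)\<rparr>"

lemma group_signed_perms: "group signed_perms"
proof (rule groupI)
  fix x :: "('n::finite \<Rightarrow> 'n) \<times> ('n \<Rightarrow> int)"
  assume "x \<in> carrier signed_perms"
  then obtain \<sigma> a where x: "x = (\<sigma>, a)" "bij \<sigma>" "\<And>i. a i \<in> {1, -1}"
    by (auto simp: signed_perms_def)
  have sq: "a i * a i = 1" for i using x(3)[of i] by auto
  show "\<exists>y\<in>carrier signed_perms. y \<otimes>\<^bsub>signed_perms\<^esub> x = \<one>\<^bsub>signed_perms\<^esub>"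
    using x sq
    by (intro bexI[of _ "(inv_into UNIV \<sigma>, \<lambda>i. a (inv_into UNIV \<sigma> i))"])
       (auto simp: signed_perms_def bij_imp_bij_inv bij_is_inj)
next
  fix x y z :: "('n::finite \<Rightarrow> 'n) \<times> ('n \<Rightarrow> int)"
  assume "x \<in> carrier signed_perms" "y \<in> carrier signed_perms"
  then show "x \<otimes>\<^bsub>signed_perms\<^esub> y \<in> carrier signed_perms"
    by (auto simp: signed_perms_def bij_comp) (metis mult_minus_right mult_minus_left mult_1 minus_minus)+
qed (auto simp: signed_perms_def comp_assoc mult.assoc)


subsection \<open>The commutative polynomial ring\<close>

type_synonym ('n, 'k) comm_poly = "('n \<Rightarrow>\<^sub>0 nat) \<Rightarrow>\<^sub>0 'k"

definition comm_var :: "'n \<Rightarrow> ('n, 'k::field) comm_poly" where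
  "comm_var i = Poly_Mapping.single (Poly_Mapping.single i 1) 1"

definition comm_homogeneous :: "nat \<Rightarrow> ('n::finite, 'k::field) comm_poly set" where
  "comm_homogeneous d =
     {f. \<forall>m\<in>Poly_Mapping.keys f. (\<Sum>i\<in>UNIV. Poly_Mapping.lookup m i) = d}"

fun comm_act ::
    "('n::finite \<Rightarrow> 'n) \<times> ('n \<Rightarrow> int) \<Rightarrow> ('n, 'k::field) comm_poly \<Rightarrow> ('n, 'k) comm_poly" where
  "comm_act (\<sigma>, a) f =
     (\<Sum>m\<in>Poly_Mapping.keys f. Poly_Mapping.single 0 (Poly_Mapping.lookup f m) *
        (\<Prod>i\<in>UNIV. (of_int (a i) * comm_var (\<sigma> i)) ^ Poly_Mapping.lookup m i))"

definition comm_invariants ::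
    "(('n::finite \<Rightarrow> 'n) \<times> ('n \<Rightarrow> int)) set \<Rightarrow> nat \<Rightarrow> ('n, 'k::field) comm_poly set" where
  "comm_invariants G d = {f \<in> comm_homogeneous d. \<forall>g\<in>G. comm_act g f = f}"


subsection \<open>The free algebra\<close>

datatype 'n free_word = Free_Word (letters: "'n list")

instantiation free_word :: (type) monoid_add
begin
definition "0 = Free_Word []"
definition "v + w = Free_Word (letters v @ letters w)"
instance by standard (auto simp: zero_free_word_def plus_free_word_def)
end

lemma letters_add: "letters (v + w) = letters v @ letters w"
  by (simp add: plus_free_word_def)

type_synonym ('n, 'k) free_algebra = "'n free_word \<Rightarrow>\<^sub>0 'k"

definition free_var :: "'n \<Rightarrow> ('n, 'k::field) free_algebra" where
  "free_var i = Poly_Mapping.single (Free_Word [i]) 1"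

definition free_homogeneous :: "nat \<Rightarrow> ('n, 'k::field) free_algebra set" where
  "free_homogeneous d = {f. \<forall>w\<in>Poly_Mapping.keys f. length (letters w) = d}"

fun free_act ::
    "('n \<Rightarrow> 'n) \<times> ('n \<Rightarrow> int) \<Rightarrow> ('n, 'k::field) free_algebra \<Rightarrow> ('n, 'k) free_algebra" where
  "free_act (\<sigma>, a) f =
     (\<Sum>w\<in>Poly_Mapping.keys f. Poly_Mapping.single 0 (Poly_Mapping.lookup f w) *
        prod_list (map (\<lambda>i. of_int (a i) * free_var (\<sigma> i)) (letters w)))"

lemma poly_mapping_single_induct:
  assumes "P 0" "\<And>v c. P (Poly_Mapping.single v c)" "\<And>p q. P p \<Longrightarrow> P q \<Longrightarrow> P (p + q)"
  shows "P (p :: 'a \<Rightarrow>\<^sub>0 'b::comm_monoid_add)"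
proof (induction p rule: Poly_Mapping.update_induct)
  case const
  then show ?case by (rule assms)
next
  case (update f a b)
  have "Poly_Mapping.update a b f = Poly_Mapping.single a b + f"
    using update(1) by (intro poly_mapping_eqI) (auto simp: lookup_update lookup_add lookup_single in_keys_iff)
  then show ?case using assms update by simp
qed

lemma free_act_add: "free_act g (p + q) = free_act g p + free_act g q"
proof (cases g)
  case (Pair \<sigma> a)
  show ?thesis unfolding Pair free_act.simps
    by (rule setsum_keys_plus_distrib) (auto simp: single_add distrib_right)
qed

lemma free_act_0: "free_act g 0 = 0"
  by (cases g) simp

lemma free_act_single:
  "free_act (\<sigma>, a) (Poly_Mapping.single w c) = Poly_Mapping.single 0 c *
     prod_list (map (\<lambda>i. of_int (a i) * free_var (\<sigma> i)) (letters w))"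
  by (cases "c = 0") simp_all

lemma free_act_free_var: "free_act (\<sigma>, a) (free_var i) = of_int (a i) * free_var (\<sigma> i)"
  by (simp add: free_var_def free_act_single)

lemma single_0_commutes:
  "p * Poly_Mapping.single 0 (c::'k::field) = Poly_Mapping.single 0 c * (p :: ('n, 'k) free_algebra)"
  by (induction p rule: poly_mapping_single_induct)
     (simp_all add: mult_single distrib_left distrib_right mult.commute[of c])

lemma free_act_mult: "free_act g (p * q) = free_act g p * free_act g (q :: ('a, 'b::field) free_algebra)"
proof -
  obtain \<sigma> a where g: "g = (\<sigma>, a)" by (cases g)
  have 1: "free_act g (Poly_Mapping.single v c * Poly_Mapping.single w d) =
      free_act g (Poly_Mapping.single v c) * free_act g (Poly_Mapping.single w d)" for v w and c d :: 'b
  proof -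
    let ?P = "\<lambda>u. prod_list (map (\<lambda>i. of_int (a i) * free_var (\<sigma> i)) (letters u)) :: ('a, 'b) free_algebra"
    have "free_act g (Poly_Mapping.single v c * Poly_Mapping.single w d) =
        Poly_Mapping.single 0 c * (Poly_Mapping.single 0 d * ?P v) * ?P w"
      by (simp add: g mult_single free_act_single letters_add flip: mult.assoc)
    also have "\<dots> = Poly_Mapping.single 0 c * ?P v * (Poly_Mapping.single 0 d * ?P w)"
      by (simp only: single_0_commutes[of "?P v" d, symmetric] mult.assoc)
    finally show ?thesis by (simp add: g free_act_single)
  qed
  have 2: "free_act g (Poly_Mapping.single v c * q) = free_act g (Poly_Mapping.single v c) * free_act g q" for v c
    by (induction q rule: poly_mapping_single_induct)
       (simp_all add: 1 free_act_0 free_act_add distrib_left)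
  show ?thesis
    by (induction p rule: poly_mapping_single_induct)
       (simp_all add: 2 free_act_0 free_act_add distrib_right)
qed


subsection \<open>The $(-1)$-skew polynomial ring\<close>

text \<open>The two-sided ideal generated by \<open>x\<^sub>i x\<^sub>j + x\<^sub>j x\<^sub>i\<close> for \<open>i \<noteq> j\<close>.\<close>

definition skew_ideal :: "('n, 'k::field) free_algebra set" where
  "skew_ideal =
     finite_sums {f * (free_var i * free_var j + free_var j * free_var i) * g | f g i j. i \<noteq> j}"

lemma finite_sums_0: "0 \<in> finite_sums S"
  unfolding finite_sums_def by (auto intro: exI[of _ "[]"])

lemma finite_sums_add: "x \<in> finite_sums S \<Longrightarrow> y \<in> finite_sums S \<Longrightarrow> x + y \<in> finite_sums S"
  unfolding finite_sums_def by (clarsimp, metis set_append sum_list_append Un_least)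

lemma finite_sums_base: "x \<in> S \<Longrightarrow> x \<in> finite_sums S"
  unfolding finite_sums_def by (auto intro: exI[of _ "[x]"])

lemma finite_sums_hom:
  assumes "x \<in> finite_sums S" "h 0 = 0" "\<And>x y. h (x + y) = h x + h y" "\<And>x. x \<in> S \<Longrightarrow> h x \<in> T"
  shows "h x \<in> finite_sums T"
proof -
  obtain xs where xs: "x = sum_list xs" "set xs \<subseteq> S"
    using assms(1) by (auto simp: finite_sums_def)
  have "h (sum_list xs) \<in> finite_sums T"
    using xs(2)
    by (induction xs)
       (auto simp: assms(2,3) intro!: finite_sums_0 finite_sums_add intro: finite_sums_base assms(4))
  then show ?thesis using xs by simp
qed

lemma skew_ideal_0: "0 \<in> skew_ideal"
  and skew_ideal_add: "x \<in> skew_ideal \<Longrightarrow> y \<in> skew_ideal \<Longrightarrow> x + y \<in> skew_ideal"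
  unfolding skew_ideal_def by (auto intro: finite_sums_0 finite_sums_add)

lemma skew_ideal_mult_left:
  assumes "x \<in> skew_ideal"
  shows "y * x \<in> skew_ideal"
  unfolding skew_ideal_def
proof (rule finite_sums_hom[OF assms[unfolded skew_ideal_def]])
  fix z :: "('a, 'b) free_algebra"
  assume "z \<in> {f * (free_var i * free_var j + free_var j * free_var i) * g | f g i j. i \<noteq> j}"
  then obtain f g i j where "z = f * (free_var i * free_var j + free_var j * free_var i) * g"
    and "i \<noteq> j" by blast
  then have "y * z = (y * f) * (free_var i * free_var j + free_var j * free_var i) * g"
    by (simp only: mult.assoc)
  with \<open>i \<noteq> j\<close> show "y * z \<in> {f * (free_var i * free_var j + free_var j * free_var i) * g | f g i j. i \<noteq> j}"
    by blast
qed (simp_all only: mult_zero_right distrib_left)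

lemma skew_ideal_mult_right:
  assumes "x \<in> skew_ideal"
  shows "x * y \<in> skew_ideal"
  unfolding skew_ideal_def
proof (rule finite_sums_hom[where h = "\<lambda>x. x * y", OF assms[unfolded skew_ideal_def]])
  fix z :: "('a, 'b) free_algebra"
  assume "z \<in> {f * (free_var i * free_var j + free_var j * free_var i) * g | f g i j. i \<noteq> j}"
  then obtain f g i j where "z = f * (free_var i * free_var j + free_var j * free_var i) * g"
    and "i \<noteq> j" by blast
  then have "z * y = f * (free_var i * free_var j + free_var j * free_var i) * (g * y)"
    by (simp only: mult.assoc)
  with \<open>i \<noteq> j\<close> show "z * y \<in> {f * (free_var i * free_var j + free_var j * free_var i) * g | f g i j. i \<noteq> j}"
    by blast
qed (simp_all only: mult_zero_left distrib_right)

lemma skew_ideal_uminus: "x \<in> skew_ideal \<Longrightarrow> - x \<in> skew_ideal"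
  using skew_ideal_mult_left[of x "-1"] by simp

lemma skew_ideal_minus_commute: "x - y \<in> skew_ideal \<Longrightarrow> y - x \<in> skew_ideal"
  using skew_ideal_uminus[of "x - y"] by simp

lemma skew_ideal_trans: "x - y \<in> skew_ideal \<Longrightarrow> y - z \<in> skew_ideal \<Longrightarrow> x - z \<in> skew_ideal"
  using skew_ideal_add[of "x - y" "y - z"] by simp

lemma skew_ideal_const:
  assumes "x \<in> skew_ideal"
  shows "Poly_Mapping.lookup x 0 = 0"
proof -
  obtain xs where x: "x = sum_list xs" and
    xs: "set xs \<subseteq> {f * (free_var i * free_var j + free_var j * free_var i) * g | f g i j. i \<noteq> j}"
    using assms by (auto simp: skew_ideal_def finite_sums_def)
  have "Poly_Mapping.lookup (f * (free_var i * free_var j + free_var j * free_var i) * g) 0 = 0"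
    for f g :: "('a, 'b) free_algebra" and i j
  proof (rule ccontr)
    let ?r = "free_var i * free_var j + free_var j * free_var i :: ('a, 'b) free_algebra"
    assume "Poly_Mapping.lookup (f * ?r * g) 0 \<noteq> 0"
    then have "0 \<in> Poly_Mapping.keys (f * ?r * g)" by (simp add: in_keys_iff)
    then obtain u v w where "v \<in> Poly_Mapping.keys ?r" "0 = u + v + w"
      using keys_mult[of "f * ?r" g] keys_mult[of f ?r] by blast
    moreover have "Poly_Mapping.keys ?r \<subseteq> {Free_Word [i, j], Free_Word [j, i]}"
      using Poly_Mapping.keys_add[of "free_var i * free_var j" "free_var j * free_var i :: ('a, 'b) free_algebra"]
      by (auto simp: free_var_def mult_single plus_free_word_def)
    ultimately show False by (auto simp: zero_free_word_def plus_free_word_def)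
  qed
  then have "y \<in> set xs \<Longrightarrow> Poly_Mapping.lookup y 0 = 0" for y using xs by auto
  then have "Poly_Mapping.lookup (sum_list xs) 0 = 0"
    by (induction xs) (auto simp: lookup_add)
  then show ?thesis by (simp add: x)
qed

quotient_type (overloaded) ('n, 'k) skew_poly =
    "('n, 'k::field) free_algebra" / "\<lambda>f g. f - g \<in> skew_ideal"
  morphisms rep_skew mk_skew
  by (rule equivpI)
     (auto intro!: reflpI sympI transpI intro: skew_ideal_0 skew_ideal_minus_commute skew_ideal_trans)

instantiation skew_poly :: (type, field) ring_1
begin

lift_definition zero_skew_poly :: "('a, 'b) skew_poly" is 0 .

lift_definition one_skew_poly :: "('a, 'b) skew_poly" is 1 .

lift_definition plus_skew_poly ::
  "('a, 'b) skew_poly \<Rightarrow> ('a, 'b) skew_poly \<Rightarrow> ('a, 'b) skew_poly" is "(+)"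
proof -
  fix f f' g g' :: "('a, 'b) free_algebra"
  assume "f - f' \<in> skew_ideal" "g - g' \<in> skew_ideal"
  then have "(f - f') + (g - g') \<in> skew_ideal" by (rule skew_ideal_add)
  then show "f + g - (f' + g') \<in> skew_ideal" by (simp only: add_diff_add)
qed

lift_definition uminus_skew_poly :: "('a, 'b) skew_poly \<Rightarrow> ('a, 'b) skew_poly" is uminus
proof -
  fix f f' :: "('a, 'b) free_algebra"
  assume "f - f' \<in> skew_ideal"
  then have "f' - f \<in> skew_ideal" by (rule skew_ideal_minus_commute)
  then show "- f - - f' \<in> skew_ideal" by simp
qed

definition "(x :: ('a, 'b) skew_poly) - y = x + - y"

lift_definition times_skew_poly ::
  "('a, 'b) skew_poly \<Rightarrow> ('a, 'b) skew_poly \<Rightarrow> ('a, 'b) skew_poly" is "(*)"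
proof -
  fix f f' g g' :: "('a, 'b) free_algebra"
  assume "f - f' \<in> skew_ideal" "g - g' \<in> skew_ideal"
  then have "(f - f') * g + f' * (g - g') \<in> skew_ideal"
    by (intro skew_ideal_add skew_ideal_mult_left skew_ideal_mult_right)
  then show "f * g - f' * g' \<in> skew_ideal" by (simp add: algebra_simps)
qed

instance
proof
  fix x y z :: "('a, 'b) skew_poly"
  show "x + y + z = x + (y + z)" by transfer (simp only: add.assoc diff_self skew_ideal_0)
  show "x + y = y + x" by transfer (simp only: add.commute diff_self skew_ideal_0)
  show "0 + x = x" by transfer (simp only: add_0_left add_0_right mult_1_left mult_1_right left_minus diff_self skew_ideal_0)
  show "- x + x = 0" by transfer (simp only: add_0_left add_0_right mult_1_left mult_1_right left_minus diff_self skew_ideal_0)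
  show "x - y = x + - y" by (rule minus_skew_poly_def)
  show "x * y * z = x * (y * z)" by transfer (simp only: mult.assoc diff_self skew_ideal_0)
  show "1 * x = x" by transfer (simp only: add_0_left add_0_right mult_1_left mult_1_right left_minus diff_self skew_ideal_0)
  show "x * 1 = x" by transfer (simp only: add_0_left add_0_right mult_1_left mult_1_right left_minus diff_self skew_ideal_0)
  show "(x + y) * z = x * z + y * z" by transfer (simp only: distrib_right diff_self skew_ideal_0)
  show "x * (y + z) = x * y + x * z" by transfer (simp only: distrib_left diff_self skew_ideal_0)
  show "(0 :: ('a, 'b) skew_poly) \<noteq> 1"
  proof (transfer, rule notI)
    assume "0 - (1 :: ('a, 'b) free_algebra) \<in> skew_ideal"
    from skew_ideal_const[OF this] show False by (simp add: lookup_minus)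
  qed
qed

end

definition skew_homogeneous :: "nat \<Rightarrow> ('n, 'k::field) skew_poly set" where
  "skew_homogeneous d = mk_skew ` free_homogeneous d"

text \<open>
  The choice of representative is immaterial for signed permutations: see \<open>skew_act_mk_skew\<close> below.
\<close>

definition skew_act ::
    "('n \<Rightarrow> 'n) \<times> ('n \<Rightarrow> int) \<Rightarrow> ('n, 'k::field) skew_poly \<Rightarrow> ('n, 'k) skew_poly" where
  "skew_act g f = mk_skew (free_act g (rep_skew f))"

lemma skew_act_mk_skew:
  assumes "g \<in> carrier signed_perms"
  shows "skew_act g (mk_skew f) = mk_skew (free_act g f)"
proof -
  obtain \<sigma> a where g: "g = (\<sigma>, a)" by (cases g)
  have "inj \<sigma>" using assms by (auto simp: g signed_perms_def bij_is_inj)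
  have ideal: "free_act g x \<in> skew_ideal" if "x \<in> skew_ideal" for x :: "('a, 'b) free_algebra"
  proof -
    let ?r = "\<lambda>i j. free_var i * free_var j + free_var j * free_var i :: ('a, 'b) free_algebra"
    have "of_int s * x * (of_int t * y) = of_int (s * t) * (x * y)"
      for s t and x y :: "('a, 'b) free_algebra"
    proof -
      have "of_int s * x * (of_int t * y) = of_int s * (x * of_int t) * y"
        by (simp only: mult.assoc)
      also have "x * of_int t = of_int t * x" by (rule mult_of_int_commute[symmetric])
      finally show ?thesis by (simp only: mult.assoc of_int_mult)
    qed
    then have "free_act g (?r i j) = of_int (a i * a j) * ?r (\<sigma> i) (\<sigma> j)" for i j
      by (simp only: g free_act_add free_act_mult free_act_free_var distrib_left mult.commute[of "a j"])
    then have *: "free_act g (f * ?r i j * h) =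
        (free_act g f * of_int (a i * a j)) * ?r (\<sigma> i) (\<sigma> j) * free_act g h" for f h i j
      by (simp only: free_act_mult mult.assoc)
    have "\<sigma> i \<noteq> \<sigma> j" if "i \<noteq> j" for i j
      using that \<open>inj \<sigma>\<close> by (auto dest: injD)
    then have "free_act g y \<in> {f * ?r i j * h | f h i j. i \<noteq> j}"
      if "y \<in> {f * ?r i j * h | f h i j. i \<noteq> j}" for y
      using that * by blast
    with that show ?thesis unfolding skew_ideal_def
      by (intro finite_sums_hom[where h = "free_act g"] free_act_0 free_act_add)
  qed
  have "rep_skew (mk_skew f) - f \<in> skew_ideal"
    by (rule Quotient3_rep_abs[OF Quotient3_skew_poly]) (simp add: skew_ideal_0)
  from ideal[OF this] have "free_act g (rep_skew (mk_skew f)) - free_act g f \<in> skew_ideal"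
    using free_act_add[of g "rep_skew (mk_skew f) - f" f] by (simp add: algebra_simps)
  then show ?thesis
    unfolding skew_act_def by (simp add: skew_poly.abs_eq_iff)
qed

definition skew_invariants ::
    "(('n::finite \<Rightarrow> 'n) \<times> ('n \<Rightarrow> int)) set \<Rightarrow> nat \<Rightarrow> ('n, 'k::field) skew_poly set" where
  "skew_invariants G d = {f \<in> skew_homogeneous d. \<forall>g\<in>G. skew_act g f = f}"

text \<open>
  A caveat about one variable: if \<open>n = 1\<close>, the characteristic of \<open>'k\<close> is not 2 and \<open>G = {\<plusminus>1}\<close>, then
  both invariant rings are \<open>k[x\<^sup>2]\<close>, whose generator has degree \<open>2 > n\<^sup>2\<close>.  So the bound \<open>n\<^sup>2\<close> on
  \<open>max_gen_degree\<close> has to exclude this one case.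
\<close>

end

theory Submission
  imports Defs "HOL-Library.Countable" "HOL-Library.Multiset"
begin

text \<open>
  The argument is Goebel's, with \<open>x\<^sub>i\<^sup>2\<close> in place of \<open>x\<^sub>i\<close>.  If a monomial \<open>m\<close> has degree more than \<open>n\<^sup>2\<close>,
  then for some nonempty block \<open>T\<close> of variables the exponents in \<open>T\<close> are at least \<open>2\<close> and exceed all
  other exponents by more than \<open>2\<close>: otherwise the ordered exponents are at most \<open>1, 3, 5, \<dots>\<close>, whose
  sum is \<open>n\<^sup>2\<close>.  Divide \<open>m\<close> by \<open>x\<^sub>T\<^sup>2\<close> and multiply the quotient by the elementary symmetric polynomial
  of degree \<open>|T|\<close> in the squares of the variables.  This gives back \<open>m\<close> plus monomials with a strictly
  smaller sum of squared exponents.  The division commutes with signed permutations, so an invariant is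
  a combination of products of invariants of smaller degree, up to an invariant of smaller norm.

  In the skew ring the \<open>x\<^sub>i\<^sup>2\<close> are central, and signed permutations act on the monomial basis by a
  permutation and signs that depend only on the parities of the exponents, so the same argument applies.

  For one variable, where the group acts trivially, the argument is run with \<open>x\<^sub>i\<close> instead of \<open>x\<^sub>i\<^sup>2\<close>;
  hence the parameter \<open>q \<in> {1, 2}\<close>.
\<close>

subsection \<open>Reduction of monomials\<close>

abbreviation expo :: "('n \<Rightarrow>\<^sub>0 nat) \<Rightarrow> 'n \<Rightarrow> nat" where
  "expo \<equiv> Poly_Mapping.lookup"

definition total_degree :: "('n::finite \<Rightarrow>\<^sub>0 nat) \<Rightarrow> nat" where
  "total_degree m = (\<Sum>i\<in>UNIV. expo m i)"

definition sq_norm :: "('n::finite \<Rightarrow>\<^sub>0 nat) \<Rightarrow> nat" where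
  "sq_norm m = (\<Sum>i\<in>UNIV. (expo m i)\<^sup>2)"

definition permute_mono :: "('n::finite \<Rightarrow> 'n) \<Rightarrow> ('n \<Rightarrow>\<^sub>0 nat) \<Rightarrow> ('n \<Rightarrow>\<^sub>0 nat)" where
  "permute_mono \<sigma> m = (\<Sum>i\<in>UNIV. Poly_Mapping.single (\<sigma> i) (expo m i))"

text \<open>The exponent vector of the product of the \<open>q\<close>-th powers of the variables in
  \<open>T\<close>.\<close>

definition box :: "nat \<Rightarrow> 'n::finite set \<Rightarrow> ('n \<Rightarrow>\<^sub>0 nat)" where
  "box q T = (\<Sum>i\<in>T. Poly_Mapping.single i q)"

lemma lookup_box: "expo (box q T) i = (if i \<in> T then q else 0)"
  by (simp add: box_def lookup_sum lookup_single when_def sum.delta')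

lemma box_empty [simp]: "box q {} = 0"
  by (simp add: box_def)

lemma permute_mono_add: "permute_mono \<sigma> (m + m') = permute_mono \<sigma> m + permute_mono \<sigma> m'"
  by (simp add: permute_mono_def lookup_add single_add sum.distrib)

lemma permute_mono_single: "permute_mono \<sigma> (Poly_Mapping.single i c) = Poly_Mapping.single (\<sigma> i) c"
proof -
  have "permute_mono \<sigma> (Poly_Mapping.single i c) =
      (\<Sum>j\<in>UNIV. if j = i then Poly_Mapping.single (\<sigma> j) c else 0)"
    unfolding permute_mono_def by (intro sum.cong) (auto simp: lookup_single when_def)
  then show ?thesis by (simp add: sum.delta)
qed

lemma permute_mono_0 [simp]: "permute_mono \<sigma> 0 = 0"
  by (simp add: permute_mono_def)

lemma permute_mono_sum: "permute_mono \<sigma> (sum f I) = (\<Sum>i\<in>I. permute_mono \<sigma> (f i))"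
  by (induction I rule: infinite_finite_induct) (simp_all add: permute_mono_add)

lemma lookup_permute_mono:
  assumes "inj \<sigma>"
  shows "expo (permute_mono \<sigma> m) (\<sigma> i) = expo m i"
  using assms by (simp add: permute_mono_def lookup_sum lookup_single when_def inj_eq sum.delta)

lemma permute_mono_inj:
  assumes "inj \<sigma>"
  shows "inj (permute_mono \<sigma>)"
  by (rule injI, rule poly_mapping_eqI) (metis assms lookup_permute_mono)

lemma permute_mono_box:
  assumes "inj \<sigma>"
  shows "permute_mono \<sigma> (box q T) = box q (\<sigma> ` T)"
  using inj_on_subset[OF assms, of T]
  by (simp add: box_def permute_mono_sum permute_mono_single sum.reindex)

lemma range_permute_mono:
  assumes "bij \<sigma>"
  shows "range (expo (permute_mono \<sigma> m)) = range (expo m)"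
proof -
  have "range (expo (permute_mono \<sigma> m)) = expo (permute_mono \<sigma> m) ` range \<sigma>"
    using assms by (simp add: bij_is_surj)
  also have "\<dots> = range (expo m)"
    using assms by (simp add: image_image lookup_permute_mono bij_is_inj)
  finally show ?thesis .
qed

lemma total_degree_add: "total_degree (m + m') = total_degree m + total_degree m'"
  by (simp add: total_degree_def lookup_add sum.distrib)

lemma total_degree_box: "total_degree (box q T) = q * card T"
  by (simp add: total_degree_def lookup_box sum.If_cases)

text \<open>For fixed \<open>b\<close> and fixed size of \<open>T\<close>, the norm depends on
  \<open>T\<close> only through the sum of the exponents of \<open>b\<close> over
  \<open>T\<close>.\<close>

lemma sq_norm_add_box:
  "sq_norm (b + box q T) = sq_norm b + 2 * q * (\<Sum>i\<in>T. expo b i) + q\<^sup>2 * card T"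
proof -
  have "(expo (b + box q T) i)\<^sup>2 = (expo b i)\<^sup>2 + (if i \<in> T then 2 * q * expo b i + q\<^sup>2 else 0)" for i
    by (simp add: lookup_add lookup_box power2_sum)
  then have "sq_norm (b + box q T) = sq_norm b + (\<Sum>i\<in>T. 2 * q * expo b i + q\<^sup>2)"
    by (simp add: sq_norm_def sum.distrib sum.If_cases)
  then show ?thesis by (simp add: sum.distrib sum_distrib_left)
qed

text \<open>Cancel the common part of \<open>S\<close> and \<open>T\<close>. The remainders have
  equal size, and any bijection from \<open>S - T\<close> to \<open>T - S\<close> increases every
  term.\<close>

lemma sum_less_of_dominated:
  fixes f :: "'a \<Rightarrow> nat"
  assumes "finite S" "finite T" "card S = card T" "S \<noteq> T"
    and less: "\<And>i j. i \<in> T \<Longrightarrow> j \<notin> T \<Longrightarrow> f j < f i"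
  shows "sum f S < sum f T"
proof -
  have "card (S - T) = card (T - S)"
    using assms card_Diff_subset_Int[of S T] card_Diff_subset_Int[of T S] by (simp add: Int_commute)
  then obtain h where h: "bij_betw h (S - T) (T - S)"
    using assms by (meson finite_Diff finite_same_card_bij)
  have "S - T \<noteq> {}"
    using assms by (metis Diff_eq_empty_iff card_subset_eq)
  then have "sum f (S - T) < (\<Sum>i\<in>S - T. f (h i))"
    using assms h by (intro sum_strict_mono less) (auto simp: bij_betw_def)
  also have "\<dots> = sum f (T - S)" by (rule sum.reindex_bij_betw[OF h])
  finally show ?thesis
    using assms sum.Int_Diff[of S f T] sum.Int_Diff[of T f S] by (simp add: Int_commute)
qed

text \<open>\<open>q \<le> t\<close> lets \<open>q\<close> be subtracted from every exponent that is
  at least \<open>t\<close>. The gap is wider than \<open>q\<close>, so the lowered exponents still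
  strictly exceed the remaining ones.\<close>

definition gap :: "nat \<Rightarrow> nat set \<Rightarrow> nat \<Rightarrow> bool" where
  "gap q R t \<longleftrightarrow> t \<in> R \<and> q \<le> t \<and> (\<forall>r\<in>R. t \<le> r \<or> r + q < t)"

text \<open>Add the elements in increasing order of \<open>f\<close>. Without a gap, each new
  maximum is below \<open>q\<close> or at most \<open>q\<close> above an earlier value, so the
  \<open>k\<close>-th value is at most \<open>q * k - 1\<close>.\<close>

lemma sum_le_of_no_gap:
  fixes f :: "'a \<Rightarrow> nat"
  assumes "finite S" "0 < q" "\<nexists>t. gap q (f ` S) t"
  shows "(\<forall>i\<in>S. f i < q * card S) \<and> sum f S \<le> (\<Sum>j<card S. q * Suc j - 1)"
  using assms(1,3)
proof (induction S rule: finite_ranking_induct[where f = f])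
  case empty
  then show ?case by simp
next
  case (insert x S)
  show ?case
  \<comment> \<open>The ranking induction does not guarantee that \<open>x\<close> is new.\<close>
  proof (cases "x \<in> S")
    case True
    with insert show ?thesis by (simp add: insert_absorb)
  next
    case False
    \<comment> \<open>The new value is a maximum, hence at least \<open>t\<close>, and cannot
      destroy the gap.\<close>
    have "gap q (f ` insert x S) t" if "gap q (f ` S) t" for t
      using that insert.hyps(2) by (auto simp: gap_def)
    then have "\<nexists>t. gap q (f ` S) t" using insert.prems by blast
    note IH = insert.IH[OF this]
    have "\<not> gap q (f ` insert x S) (f x)" using insert.prems by blast
    then have "f x < q \<or> (\<exists>i\<in>S. f x \<le> f i + q)"
      by (auto simp: gap_def not_le not_less)
    moreover have "q \<le> q * Suc (card S)" by simp
    moreover have "f i + q < q * Suc (card S)" if "i \<in> S" for i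
      using IH that by (simp add: algebra_simps)
    ultimately have x: "f x < q * Suc (card S)" by fastforce
    have "f i < q * Suc (card S)" if "i \<in> S" for i
      using x insert.hyps(2)[OF that] by linarith
    then show ?thesis
      using x IH False insert.hyps(1) by auto
  qed
qed

text \<open>\<open>LEAST\<close> makes the threshold depend only on the set of exponent values,
  which permuting the variables preserves.\<close>

definition top_block :: "nat \<Rightarrow> ('n::finite \<Rightarrow>\<^sub>0 nat) \<Rightarrow> 'n set" where
  "top_block q m = {i. (LEAST t. gap q (range (expo m)) t) \<le> expo m i}"

lemma top_block_permute:
  assumes "bij \<sigma>"
  shows "top_block q (permute_mono \<sigma> m) = \<sigma> ` top_block q m"
proof -
  have "i \<in> top_block q (permute_mono \<sigma> m) \<longleftrightarrow> i \<in> \<sigma> ` top_block q m" for i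
  proof -
    obtain j where i: "i = \<sigma> j" using bij_is_surj[OF assms] by blast
    show ?thesis
      using bij_is_inj[OF assms]
      by (simp add: i top_block_def range_permute_mono[OF assms] lookup_permute_mono inj_image_mem_iff)
  qed
  then show ?thesis by blast
qed

text \<open>By \<open>sum_le_of_no_gap\<close> such a degree forces a gap, so the
  \<open>LEAST\<close> in \<open>top_block\<close> is a genuine threshold.\<close>

lemma top_block_props:
  fixes m :: "'n::finite \<Rightarrow>\<^sub>0 nat"
  assumes "0 < q" "(\<Sum>j<CARD('n). q * Suc j - 1) < total_degree m"
  shows "top_block q m \<noteq> {}"
    and "i \<in> top_block q m \<Longrightarrow> q \<le> expo m i"
    and "i \<in> top_block q m \<Longrightarrow> j \<notin> top_block q m \<Longrightarrow> expo m j + q < expo m i"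
proof -
  define t where "t = (LEAST t. gap q (range (expo m)) t)"
  have "\<exists>t. gap q (range (expo m)) t"
    using sum_le_of_no_gap[of UNIV q "expo m"] assms by (auto simp: total_degree_def)
  then have t: "gap q (range (expo m)) t" unfolding t_def by (rule LeastI_ex)
  have top: "top_block q m = {i. t \<le> expo m i}" by (simp add: top_block_def t_def)
  show "top_block q m \<noteq> {}" using t by (auto simp: top gap_def)
  show "i \<in> top_block q m \<Longrightarrow> q \<le> expo m i" using t by (auto simp: top gap_def)
  show "i \<in> top_block q m \<Longrightarrow> j \<notin> top_block q m \<Longrightarrow> expo m j + q < expo m i"
    using t by (fastforce simp: top gap_def)
qed

section \<open>Division of a monomial by its top block\<close>

definition reduce :: "nat \<Rightarrow> ('n::finite \<Rightarrow>\<^sub>0 nat) \<Rightarrow> ('n \<Rightarrow>\<^sub>0 nat)" where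
  "reduce q m = m - box q (top_block q m)"

text \<open>Truncated subtraction is done exponent by exponent, so this holds even where the
  division is not exact.\<close>

lemma reduce_permute:
  assumes "bij \<sigma>"
  shows "reduce q (permute_mono \<sigma> m) = permute_mono \<sigma> (reduce q m)"
proof (rule poly_mapping_eqI)
  fix i
  obtain j where i: "i = \<sigma> j" using bij_is_surj[OF assms] by blast
  show "expo (reduce q (permute_mono \<sigma> m)) i = expo (permute_mono \<sigma> (reduce q m)) i"
    using bij_is_inj[OF assms]
    by (simp add: i reduce_def top_block_permute[OF assms] lookup_permute_mono lookup_minus lookup_box
        inj_image_mem_iff)
qed

context
  fixes q :: nat and m :: "'n::finite \<Rightarrow>\<^sub>0 nat"
  assumes q: "0 < q" and large: "(\<Sum>j<CARD('n). q * Suc j - 1) < total_degree m"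
begin

lemma reduce_add_box: "reduce q m + box q (top_block q m) = m"
  using top_block_props(2)[OF q large]
  by (intro poly_mapping_eqI) (simp add: reduce_def lookup_add lookup_minus lookup_box)

text \<open>By the width of the gap, the exponents of \<open>reduce q m\<close> on the block still
  exceed those outside it. The block is thus the only set of its size with maximal exponent
  sum.\<close>

lemma sq_norm_reduce_add_box:
  assumes "card S = card (top_block q m)" "S \<noteq> top_block q m"
  shows "sq_norm (reduce q m + box q S) < sq_norm m"
proof -
  let ?T = "top_block q m"
  have "expo (reduce q m) j < expo (reduce q m) i" if "i \<in> ?T" "j \<notin> ?T" for i j
    using top_block_props(3)[OF q large that] that
    by (simp add: reduce_def lookup_minus lookup_box)
  then have "(\<Sum>i\<in>S. expo (reduce q m) i) < (\<Sum>i\<in>?T. expo (reduce q m) i)"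
    using assms by (intro sum_less_of_dominated) auto
  then have "sq_norm (reduce q m + box q S) < sq_norm (reduce q m + box q ?T)"
    using assms q by (simp add: sq_norm_add_box)
  then show ?thesis by (simp only: reduce_add_box)
qed

lemma total_degree_reduce: "total_degree (reduce q m) = total_degree m - q * card (top_block q m)"
  using total_degree_add[of "reduce q m" "box q (top_block q m)"]
  by (simp only: reduce_add_box total_degree_box)

end

subsection \<open>Signed permutation actions on polynomials\<close>

text \<open>One linear map serves both rings: \<open>e m\<close> is the scalar picked up by the
  monomial \<open>m\<close>, a sign character in the commutative ring, times a reordering sign in
  the skew ring.\<close>

definition monomial_act ::
    "('n::finite \<Rightarrow> 'n) \<Rightarrow> (('n \<Rightarrow>\<^sub>0 nat) \<Rightarrow> 'k::field) \<Rightarrow> ('n, 'k) comm_poly \<Rightarrow> ('n, 'k) comm_poly" where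
  "monomial_act \<sigma> e p =
     (\<Sum>m\<in>Poly_Mapping.keys p. Poly_Mapping.single (permute_mono \<sigma> m) (e m * Poly_Mapping.lookup p m))"

lemma monomial_act_single:
  "monomial_act \<sigma> e (Poly_Mapping.single m c) = Poly_Mapping.single (permute_mono \<sigma> m) (e m * c)"
  by (cases "c = 0") (simp_all add: monomial_act_def)

lemma monomial_act_0 [simp]: "monomial_act \<sigma> e 0 = 0"
  by (simp add: monomial_act_def)

lemma monomial_act_add: "monomial_act \<sigma> e (p + r) = monomial_act \<sigma> e p + monomial_act \<sigma> e r"
  unfolding monomial_act_def by (rule setsum_keys_plus_distrib) (auto simp: single_add distrib_left)

lemma monomial_act_sum: "monomial_act \<sigma> e (sum f I) = (\<Sum>i\<in>I. monomial_act \<sigma> e (f i))"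
  by (induction I rule: infinite_finite_induct) (simp_all add: monomial_act_add)

lemma monomial_act_diff: "monomial_act \<sigma> e (p - r) = monomial_act \<sigma> e p - monomial_act \<sigma> e r"
  using monomial_act_add[of \<sigma> e "p - r" r] by (simp add: algebra_simps)

lemma poly_mapping_sum_singles:
  "(\<Sum>m\<in>Poly_Mapping.keys p. Poly_Mapping.single m (Poly_Mapping.lookup p m)) = p"
  by (rule poly_mapping_eqI)
     (auto simp: lookup_sum lookup_single when_def sum.delta' in_keys_iff)

lemma comm_homogeneous_iff: "p \<in> comm_homogeneous d \<longleftrightarrow> (\<forall>m\<in>Poly_Mapping.keys p. total_degree m = d)"
  by (simp add: comm_homogeneous_def total_degree_def)

lemma comm_homogeneous_0: "0 \<in> comm_homogeneous d"
  by (simp add: comm_homogeneous_iff)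

lemma comm_homogeneous_single: "total_degree m = d \<Longrightarrow> Poly_Mapping.single m c \<in> comm_homogeneous d"
  by (simp add: comm_homogeneous_iff)

lemma comm_homogeneous_add:
  "p \<in> comm_homogeneous d \<Longrightarrow> r \<in> comm_homogeneous d \<Longrightarrow> p + r \<in> comm_homogeneous d"
  using Poly_Mapping.keys_add[of p r] by (auto simp: comm_homogeneous_iff)

lemma comm_homogeneous_diff:
  "p \<in> comm_homogeneous d \<Longrightarrow> r \<in> comm_homogeneous d \<Longrightarrow> p - r \<in> comm_homogeneous d"
  using keys_diff[of p r] by (auto simp: comm_homogeneous_iff)

lemma comm_homogeneous_sum:
  "(\<And>i. i \<in> I \<Longrightarrow> f i \<in> comm_homogeneous d) \<Longrightarrow> sum f I \<in> comm_homogeneous d"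
  by (induction I rule: infinite_finite_induct) (auto simp: comm_homogeneous_0 comm_homogeneous_add)

lemma comm_homogeneous_mult:
  "p \<in> comm_homogeneous d \<Longrightarrow> r \<in> comm_homogeneous d' \<Longrightarrow> p * r \<in> comm_homogeneous (d + d')"
  using keys_mult[of p r] by (fastforce simp: comm_homogeneous_iff total_degree_add)

text \<open>The \<open>k\<close>-th elementary symmetric polynomial in the \<open>q\<close>-th
  powers of the variables.\<close>

definition elem_sym :: "nat \<Rightarrow> nat \<Rightarrow> ('n::finite, 'k::field) comm_poly" where
  "elem_sym q k = (\<Sum>S | card S = k. Poly_Mapping.single (box q S) 1)"

lemma elem_sym_homogeneous: "elem_sym q k \<in> comm_homogeneous (q * k)"
  unfolding elem_sym_def
  by (intro comm_homogeneous_sum comm_homogeneous_single) (auto simp: total_degree_box)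

text \<open>By \<open>e_add\<close> the scalars depend only on the exponents modulo
  \<open>q\<close>. Multiplicativity of \<open>e\<close> is not imposed, as reordering signs in the
  skew ring are not multiplicative.\<close>

locale monomial_action =
  fixes H :: "(('n::finite \<Rightarrow> 'n) \<times> (('n \<Rightarrow>\<^sub>0 nat) \<Rightarrow> 'k::field)) set" and q :: nat
  assumes q: "0 < q"
    and bij: "(\<sigma>, e) \<in> H \<Longrightarrow> bij \<sigma>"
    and e_0: "(\<sigma>, e) \<in> H \<Longrightarrow> e 0 = 1"
    and e_nonzero: "(\<sigma>, e) \<in> H \<Longrightarrow> e m \<noteq> 0"
    and e_add: "(\<sigma>, e) \<in> H \<Longrightarrow> e (m + Poly_Mapping.single i q) = e m"
begin

section \<open>Homogeneous invariants and elementary symmetric polynomials\<close>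

definition invs :: "nat \<Rightarrow> ('n, 'k) comm_poly set" where
  "invs d = {p \<in> comm_homogeneous d. \<forall>(\<sigma>, e)\<in>H. monomial_act \<sigma> e p = p}"

lemma invsD: "p \<in> invs d \<Longrightarrow> p \<in> comm_homogeneous d"
  "p \<in> invs d \<Longrightarrow> (\<sigma>, e) \<in> H \<Longrightarrow> monomial_act \<sigma> e p = p"
  by (auto simp: invs_def)

lemma invsI:
  "p \<in> comm_homogeneous d \<Longrightarrow> (\<And>\<sigma> e. (\<sigma>, e) \<in> H \<Longrightarrow> monomial_act \<sigma> e p = p) \<Longrightarrow> p \<in> invs d"
  by (auto simp: invs_def)

lemma e_add_box:
  assumes "(\<sigma>, e) \<in> H"
  shows "e (m + box q S) = e m"
proof -
  have "finite S" by simp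
  then show ?thesis
  proof (induction S)
    case (insert i S)
    then have "m + box q (insert i S) = (m + box q S) + Poly_Mapping.single i q"
      by (simp add: box_def ac_simps)
    with insert show ?case by (simp only: e_add[OF assms])
  qed simp
qed

text \<open>Multiplication by \<open>q\<close>-th powers leaves the scalars \<open>e\<close>
  unchanged, so on such factors the action is multiplicative.\<close>

lemma monomial_act_mult_box:
  assumes "(\<sigma>, e) \<in> H"
  shows "monomial_act \<sigma> e (p * Poly_Mapping.single (box q S) 1) =
     monomial_act \<sigma> e p * Poly_Mapping.single (box q (\<sigma> ` S)) 1"
proof (induction p rule: poly_mapping_single_induct)
  case 1
  show ?case by simp
next
  case (2 m c)
  show ?case
    by (simp only: mult_single monomial_act_single permute_mono_add e_add_box[OF assms]
        permute_mono_box[OF bij_is_inj[OF bij[OF assms]]] mult_1_right)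
next
  case (3 p r)
  then show ?case by (simp only: distrib_right monomial_act_add)
qed

text \<open>A bijection of the variables permutes the \<open>k\<close>-element subsets, hence the
  terms of \<open>elem_sym q k\<close>.\<close>

lemma monomial_act_mult_elem_sym:
  assumes "(\<sigma>, e) \<in> H"
  shows "monomial_act \<sigma> e (p * elem_sym q k) = monomial_act \<sigma> e p * elem_sym q k"
proof -
  note inj = bij_is_inj[OF bij[OF assms]]
  have "bij_betw (image \<sigma>) {S. card S = k} {S. card S = k}"
  proof (rule bij_betw_imageI)
    show "inj_on (image \<sigma>) {S. card S = k}"
      by (rule inj_onI) (simp add: inj_image_eq_iff[OF inj])
    have "S \<in> image \<sigma> ` {S. card S = k}" if "card S = k" for S
    proof
      show "S = \<sigma> ` (\<sigma> -` S)" using bij[OF assms] by (simp add: bij_is_surj)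
      then show "\<sigma> -` S \<in> {S. card S = k}"
        using that card_image[OF inj_on_subset[OF inj subset_UNIV], of "\<sigma> -` S"] by simp
    qed
    then show "image \<sigma> ` {S. card S = k} = {S. card S = k}"
      by (auto simp: card_image[OF inj_on_subset[OF inj subset_UNIV]])
  qed
  from sum.reindex_bij_betw[OF this, of "\<lambda>S. monomial_act \<sigma> e p * Poly_Mapping.single (box q S) 1"]
  show ?thesis
    by (simp add: elem_sym_def sum_distrib_left monomial_act_sum monomial_act_mult_box[OF assms])
qed

lemma elem_sym_invs: "elem_sym q k \<in> invs (q * k)"
proof -
  have "monomial_act \<sigma> e (elem_sym q k) = elem_sym q k" if "(\<sigma>, e) \<in> H" for \<sigma> e
  proof -
    have "monomial_act \<sigma> e 1 = 1"
      using that by (simp add: monomial_act_single e_0 flip: single_one)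
    then show ?thesis using monomial_act_mult_elem_sym[OF that, of 1 k] by simp
  qed
  then show ?thesis by (auto simp: invs_def elem_sym_homogeneous)
qed

lemma invs_mult_elem_sym: "p \<in> invs d \<Longrightarrow> p * elem_sym q k \<in> invs (d + q * k)"
  by (auto simp: invs_def monomial_act_mult_elem_sym intro!: comm_homogeneous_mult elem_sym_homogeneous)

lemma invs_diff: "p \<in> invs d \<Longrightarrow> r \<in> invs d \<Longrightarrow> p - r \<in> invs d"
  by (rule invsI) (simp_all add: invsD monomial_act_diff comm_homogeneous_diff)

lemma invs_sum: "(\<And>i. i \<in> I \<Longrightarrow> f i \<in> invs d) \<Longrightarrow> sum f I \<in> invs d"
  by (rule invsI) (auto simp: invsD(1) invsD(2)[of _ d] monomial_act_sum intro!: comm_homogeneous_sum sum.cong)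

section \<open>Reduction of invariants modulo products\<close>

lemma lookup_invariant:
  assumes "(\<sigma>, e) \<in> H" "monomial_act \<sigma> e p = p"
  shows "Poly_Mapping.lookup p (permute_mono \<sigma> m) = e m * Poly_Mapping.lookup p m"
proof -
  have "Poly_Mapping.lookup (monomial_act \<sigma> e p) (permute_mono \<sigma> m) = e m * Poly_Mapping.lookup p m"
    using permute_mono_inj[OF bij_is_inj[OF bij[OF assms(1)]]]
    by (auto simp: monomial_act_def lookup_sum lookup_single when_def inj_eq sum.delta' in_keys_iff)
  then show ?thesis by (simp add: assms(2))
qed

text \<open>The terms are grouped by the size of their block, since those with block size
  \<open>k\<close> are all to be multiplied by \<open>elem_sym q k\<close>.\<close>

definition quot :: "nat \<Rightarrow> ('n, 'k) comm_poly \<Rightarrow> ('n, 'k) comm_poly" where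
  "quot k p = (\<Sum>m\<in>{m \<in> Poly_Mapping.keys p. card (top_block q m) = k}.
     Poly_Mapping.single (reduce q m) (Poly_Mapping.lookup p m))"

text \<open>Block size and reduction are compatible with permutations, and \<open>e\<close> agrees
  on a monomial and its reduction. Hence the action only permutes the terms.\<close>

lemma quot_invs:
  assumes p: "p \<in> invs d" and d: "(\<Sum>j<CARD('n). q * Suc j - 1) < d"
  shows "quot k p \<in> invs (d - q * k)"
proof -
  let ?K = "{m \<in> Poly_Mapping.keys p. card (top_block q m) = k}"
  have "monomial_act \<sigma> e (quot k p) = quot k p" if \<sigma>: "(\<sigma>, e) \<in> H" for \<sigma> e
  proof -
    note b = bij[OF \<sigma>]
    note coeff = lookup_invariant[OF \<sigma> invsD(2)[OF p \<sigma>]]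
    have inj: "inj_on (permute_mono \<sigma>) ?K"
      using permute_mono_inj[OF bij_is_inj[OF b]] by (rule inj_on_subset) simp
    have "card (\<sigma> ` T) = card T" for T
      by (rule card_image[OF inj_on_subset[OF bij_is_inj[OF b] subset_UNIV]])
    \<comment> \<open>A coefficient of \<open>p\<close> at a permuted monomial is a nonzero multiple
      of the original one, so the support is preserved. As it is finite, the injective map is
      onto.\<close>
    then have "permute_mono \<sigma> ` ?K \<subseteq> ?K"
      using e_nonzero[OF \<sigma>] by (auto simp: in_keys_iff coeff top_block_permute[OF b])
    then have "permute_mono \<sigma> ` ?K = ?K"
      using inj by (intro endo_inj_surj) auto
    then have bb: "bij_betw (permute_mono \<sigma>) ?K ?K" using inj by (rule bij_betw_imageI[rotated])
    have "e (reduce q m) = e m" if "m \<in> ?K" for m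
    proof -
      have "total_degree m = d" using that invsD(1)[OF p] by (simp add: comm_homogeneous_iff)
      then have "reduce q m + box q (top_block q m) = m" using d by (intro reduce_add_box q) simp
      then show ?thesis using e_add_box[OF \<sigma>] by metis
    qed
    then have "monomial_act \<sigma> e (quot k p) = (\<Sum>m\<in>?K. Poly_Mapping.single (reduce q (permute_mono \<sigma> m))
        (Poly_Mapping.lookup p (permute_mono \<sigma> m)))"
      by (simp add: quot_def monomial_act_sum monomial_act_single reduce_permute[OF b] coeff)
    also have "\<dots> = quot k p"
      unfolding quot_def by (rule sum.reindex_bij_betw[OF bb])
    finally show ?thesis .
  qed
  moreover have "quot k p \<in> comm_homogeneous (d - q * k)"
    unfolding quot_def using invsD(1)[OF p] d q
    by (intro comm_homogeneous_sum comm_homogeneous_single)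
       (auto simp: comm_homogeneous_iff total_degree_reduce)
  ultimately show ?thesis by (auto simp: invs_def)
qed

lemma quot_mult_elem_sym:
  "quot k p * elem_sym q k = (\<Sum>m\<in>{m \<in> Poly_Mapping.keys p. card (top_block q m) = k}.
     \<Sum>S | card S = card (top_block q m). Poly_Mapping.single (reduce q m + box q S) (Poly_Mapping.lookup p m))"
  by (simp add: quot_def elem_sym_def sum_product mult_single)

text \<open>In the expanded products, the choice of \<open>S\<close> as the top block reproduces
  \<open>p\<close>; every other \<open>S\<close> of that size gives a monomial of smaller
  norm.\<close>

lemma reduction_step:
  assumes p: "p \<in> invs d" and d: "(\<Sum>j<CARD('n). q * Suc j - 1) < d"
  and N: "\<And>m. m \<in> Poly_Mapping.keys p \<Longrightarrow> sq_norm m \<le> N"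
  and m': "m' \<in> Poly_Mapping.keys (p - (\<Sum>k\<in>{1..CARD('n)}. quot k p * elem_sym q k))"
  shows "sq_norm m' < N"
proof -
  let ?T = "top_block q" and ?K = "Poly_Mapping.keys p"
  let ?s = "\<lambda>m S. Poly_Mapping.single (reduce q m + box q S) (Poly_Mapping.lookup p m)"
  have large: "(\<Sum>j<CARD('n). q * Suc j - 1) < total_degree m" if "m \<in> ?K" for m
    using invsD(1)[OF p] that d by (simp add: comm_homogeneous_iff)
  \<comment> \<open>Top blocks are nonempty, so summing over \<open>k\<close> from \<open>1\<close>
    on catches every monomial of \<open>p\<close>.\<close>
  have "(\<lambda>m. card (?T m)) ` ?K \<subseteq> {1..CARD('n)}"
    using top_block_props(1)[OF q large] by (auto simp: Suc_le_eq card_gt_0_iff card_mono)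
  then have "(\<Sum>k\<in>{1..CARD('n)}. quot k p * elem_sym q k) = (\<Sum>m\<in>?K. \<Sum>S | card S = card (?T m). ?s m S)"
    unfolding quot_mult_elem_sym by (rule sum.group[rotated 2]) auto
  also have "\<dots> = (\<Sum>m\<in>?K. Poly_Mapping.single m (Poly_Mapping.lookup p m) +
      (\<Sum>S\<in>{S. card S = card (?T m)} - {?T m}. ?s m S))"
  proof (rule sum.cong)
    fix m assume "m \<in> ?K"
    then show "(\<Sum>S | card S = card (?T m). ?s m S) = Poly_Mapping.single m (Poly_Mapping.lookup p m) +
      (\<Sum>S\<in>{S. card S = card (?T m)} - {?T m}. ?s m S)"
      by (subst sum.remove[of _ "?T m"]) (simp_all add: reduce_add_box[OF q large])
  qed simp
  finally have "p - (\<Sum>k\<in>{1..CARD('n)}. quot k p * elem_sym q k) =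
      - (\<Sum>m\<in>?K. \<Sum>S\<in>{S. card S = card (?T m)} - {?T m}. ?s m S)"
    by (simp add: sum.distrib poly_mapping_sum_singles)
  with m' have "m' \<in> Poly_Mapping.keys (\<Sum>m\<in>?K. \<Sum>S\<in>{S. card S = card (?T m)} - {?T m}. ?s m S)"
    by (simp only: keys_minus)
  from subsetD[OF Poly_Mapping.keys_sum this] obtain m where m: "m \<in> ?K"
    "m' \<in> Poly_Mapping.keys (\<Sum>S\<in>{S. card S = card (?T m)} - {?T m}. ?s m S)"
    by blast
  from subsetD[OF Poly_Mapping.keys_sum m(2)] obtain S where S: "card S = card (?T m)" "S \<noteq> ?T m"
    "m' \<in> Poly_Mapping.keys (?s m S)"
    by blast
  then have "m' = reduce q m + box q S" by (simp split: if_splits)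
  with sq_norm_reduce_add_box[OF q large[OF m(1)] S(1,2)] N[OF m(1)] show ?thesis by simp
qed

text \<open>Each reduction step lowers the strict norm bound \<open>N\<close> by one; at
  \<open>N = 0\<close> no monomial is left.\<close>

lemma invs_decomposition:
  assumes "p \<in> invs d" "(\<Sum>j<CARD('n). q * Suc j - 1) < d" "q * CARD('n) < d"
  shows "p \<in> finite_sums {h * elem_sym q k | h k. k \<in> {1..CARD('n)} \<and> h \<in> invs (d - q * k)}"
    (is "p \<in> finite_sums ?M")
proof -
  have "p \<in> finite_sums ?M"
    if "p \<in> invs d" "\<And>m. m \<in> Poly_Mapping.keys p \<Longrightarrow> sq_norm m < N" for p N
    using that
  proof (induction N arbitrary: p)
    case 0
    then have "p = 0" by (metis keys_eq_empty not_less0 all_not_in_conv)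
    then show ?case by (simp add: finite_sums_0)
  next
    case (Suc N)
    let ?r = "\<Sum>k\<in>{1..CARD('n)}. quot k p * elem_sym q k"
    have quot: "quot k p \<in> invs (d - q * k)" for k
      using Suc.prems(1) assms(2) by (rule quot_invs)
    have "quot k p * elem_sym q k \<in> invs d" if "k \<in> {1..CARD('n)}" for k
    proof -
      \<comment> \<open>This makes the truncated subtraction \<open>d - q * k\<close> exact.\<close>
      have "q * k \<le> q * CARD('n)" using that by simp
      then have "d - q * k + q * k = d" using assms(3) by linarith
      with invs_mult_elem_sym[OF quot, of k k] show ?thesis by simp
    qed
    then have "p - ?r \<in> invs d" using Suc.prems(1) by (intro invs_diff invs_sum)
    moreover have "sq_norm m < N" if "m \<in> Poly_Mapping.keys (p - ?r)" for m
      using reduction_step[OF Suc.prems(1) assms(2) _ that] Suc.prems(2) by (simp add: less_Suc_eq_le)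
    ultimately have "p - ?r \<in> finite_sums ?M" by (rule Suc.IH)
    moreover have "sum (\<lambda>k. quot k p * elem_sym q k) I \<in> finite_sums ?M" if "I \<subseteq> {1..CARD('n)}" for I
      using finite_subset[OF that finite_atLeastAtMost] that
    proof (induction I)
      case (insert k I)
      then have "quot k p * elem_sym q k \<in> finite_sums ?M"
        using quot by (intro finite_sums_base) blast
      with insert show ?case by (simp add: finite_sums_add)
    qed (simp add: finite_sums_0)
    ultimately have "p - ?r + ?r \<in> finite_sums ?M" by (blast intro: finite_sums_add)
    then show ?case by simp
  qed
  \<comment> \<open>The starting \<open>N\<close> is the successor of the largest norm in the finite
    support.\<close>
  from this[OF assms(1)] show ?thesis
    by (metis Max_ge finite_imageI finite_keys image_eqI less_Suc_eq_le)
qed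

text \<open>\<open>\<Phi>\<close> need only be multiplicative for right factors that are \<open>q\<close>-th powers of variables, which
  the skew polynomial ring satisfies.\<close>

lemma max_gen_degree_le:
  fixes \<Phi> :: "'a::ring_1 \<Rightarrow> ('n, 'k) comm_poly"
  assumes bij_\<Phi>: "bij \<Phi>" and add: "\<And>f g. \<Phi> (f + g) = \<Phi> f + \<Phi> g" and one: "\<Phi> 1 = 1"
    and mult: "\<And>f y i. \<Phi> y = Poly_Mapping.single (Poly_Mapping.single i q) 1 \<Longrightarrow> \<Phi> (f * y) = \<Phi> f * \<Phi> y"
    and B: "\<And>d f. f \<in> B d \<longleftrightarrow> \<Phi> f \<in> invs d"
    and D: "(\<Sum>j<CARD('n). q * Suc j - 1) \<le> D" "q * CARD('n) \<le> D"
  shows "max_gen_degree B \<le> enat D"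
proof -
  define \<Psi> where "\<Psi> = inv_into UNIV \<Phi>"
  have \<Phi>\<Psi> [simp]: "\<Phi> (\<Psi> p) = p" for p
    using bij_\<Phi> by (simp add: \<Psi>_def bij_is_surj surj_f_inv_f)
  have \<Psi>\<Phi> [simp]: "\<Psi> (\<Phi> f) = f" for f
    using bij_\<Phi> by (simp add: \<Psi>_def bij_is_inj)
  have \<Psi>_add: "\<Psi> (p + r) = \<Psi> p + \<Psi> r" for p r
    by (metis \<Phi>\<Psi> \<Psi>\<Phi> add)
  have \<Psi>_0: "\<Psi> 0 = 0"
    using \<Psi>_add[of 0 0] by simp
  have \<Psi>_sum: "\<Psi> (sum F I) = (\<Sum>i\<in>I. \<Psi> (F i))" for F :: "'n set \<Rightarrow> _" and I
    by (induction I rule: infinite_finite_induct) (simp_all add: \<Psi>_0 \<Psi>_add)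
  \<comment> \<open>The \<open>q\<close>-th powers are split off one at a time on the right, the
    only side where \<open>mult\<close> applies.\<close>
  have \<Psi>_box: "\<Psi> (p * Poly_Mapping.single (box q S) 1) = \<Psi> p * \<Psi> (Poly_Mapping.single (box q S) 1)" for p S
  proof -
    have "finite S" by simp
    then show ?thesis
    proof (induction S arbitrary: p)
      case empty
      have "\<Psi> 1 = 1" by (metis \<Psi>\<Phi> one)
      then show ?case by simp
    next
      case (insert i S)
      let ?y = "Poly_Mapping.single (box q S) 1 :: ('n, 'k) comm_poly"
      let ?x = "Poly_Mapping.single (Poly_Mapping.single i q) 1 :: ('n, 'k) comm_poly"
      have box: "Poly_Mapping.single (box q (insert i S)) 1 = ?y * ?x"
        using insert.hyps by (simp add: box_def mult_single add.commute)
      have \<Psi>x: "\<Psi> (p * ?x) = \<Psi> p * \<Psi> ?x" for p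
        using mult[of "\<Psi> ?x" i "\<Psi> p"] by (metis \<Phi>\<Psi> \<Psi>\<Phi>)
      have "\<Psi> (p * (?y * ?x)) = \<Psi> p * \<Psi> ?y * \<Psi> ?x"
        by (simp only: mult.assoc[symmetric] \<Psi>x insert.IH)
      also have "\<dots> = \<Psi> p * \<Psi> (?y * ?x)"
        by (simp only: \<Psi>x mult.assoc)
      finally show ?case by (simp only: box)
    qed
  qed
  have \<Psi>_elem_sym: "\<Psi> (p * elem_sym q k) = \<Psi> p * \<Psi> (elem_sym q k)" for p k
    by (simp add: elem_sym_def sum_distrib_left \<Psi>_sum \<Psi>_box)
  have pos: "\<Psi> p \<in> positive_part B" if "p \<in> invs d" "1 \<le> d" for p d
    unfolding positive_part_def using that by (intro finite_sums_base) (auto simp: B)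
  have "f \<in> positive_part_square B" if f: "f \<in> B d" and "D < d" for f d
  proof -
    have "\<Phi> f \<in> finite_sums {h * elem_sym q k | h k. k \<in> {1..CARD('n)} \<and> h \<in> invs (d - q * k)}"
      using f \<open>D < d\<close> D by (intro invs_decomposition) (auto simp: B)
    then have "\<Psi> (\<Phi> f) \<in> positive_part_square B"
      unfolding positive_part_square_def
    proof (rule finite_sums_hom[OF _ \<Psi>_0 \<Psi>_add])
      fix x assume "x \<in> {h * elem_sym q k | h k. k \<in> {1..CARD('n)} \<and> h \<in> invs (d - q * k)}"
      then obtain h k where x: "x = h * elem_sym q k" and k: "1 \<le> k" "k \<le> CARD('n)"
        and h: "h \<in> invs (d - q * k)" by auto
      \<comment> \<open>The cofactor then has positive degree, so both factors lie in the positive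
        part.\<close>
      have "q * k \<le> q * CARD('n)" using k by simp
      then have "1 \<le> d - q * k" using \<open>D < d\<close> D by linarith
      with h have "\<Psi> h \<in> positive_part B" by (rule pos)
      moreover have "\<Psi> (elem_sym q k) \<in> positive_part B"
        using elem_sym_invs by (rule pos) (use q k in simp)
      ultimately show "\<Psi> x \<in> {f * g | f g. f \<in> positive_part B \<and> g \<in> positive_part B}"
        by (auto simp: x \<Psi>_elem_sym)
    qed
    then show ?thesis by simp
  qed
  then show ?thesis
    unfolding max_gen_degree_def by (intro Sup_least) (force simp: not_less[symmetric])
qed

end

subsection \<open>The two invariant rings\<close>

lemma prod_single_comm:
  "(\<Prod>i\<in>I. Poly_Mapping.single (f i) (g i)) = Poly_Mapping.single (\<Sum>i\<in>I. f i) (\<Prod>i\<in>I. g i :: 'k::comm_semiring_1)"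
  by (induction I rule: infinite_finite_induct) (simp_all add: mult_single)

definition sign_char :: "('n::finite \<Rightarrow> int) \<Rightarrow> ('n \<Rightarrow>\<^sub>0 nat) \<Rightarrow> 'k::field" where
  "sign_char a m = (\<Prod>i\<in>UNIV. of_int (a i) ^ expo m i)"

lemma comm_act_eq: "comm_act (\<sigma>, a) p = monomial_act \<sigma> (sign_char a) p"
proof -
  have "(of_int (a i) * comm_var (\<sigma> i) :: ('a, 'b) comm_poly) ^ k =
      Poly_Mapping.single (Poly_Mapping.single (\<sigma> i) k) (of_int (a i) ^ k)" for i k
    by (induction k) (simp_all add: comm_var_def mult_single single_add[symmetric] mult.commute flip: single_of_int)
  then show ?thesis
    by (simp add: monomial_act_def prod_single_comm mult_single sign_char_def permute_mono_def mult.commute)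
qed

lemma sign_char_0: "sign_char a 0 = 1"
  by (simp add: sign_char_def)

lemma sign_char_add: "sign_char a (m + m') = sign_char a m * sign_char a m'"
  by (simp add: sign_char_def lookup_add power_add prod.distrib)

lemma sign_char_single: "sign_char a (Poly_Mapping.single i c) = of_int (a i) ^ c"
proof -
  have "sign_char a (Poly_Mapping.single i c) = (\<Prod>j\<in>UNIV. if j = i then of_int (a i) ^ c else 1)"
    unfolding sign_char_def by (intro prod.cong) (auto simp: lookup_single when_def)
  then show ?thesis by simp
qed

lemma sign_char_nonzero: "(\<And>i. a i \<in> {1, -1}) \<Longrightarrow> sign_char a m \<noteq> 0"
  unfolding sign_char_def by (auto simp: prod_zero_iff) (metis of_int_1 of_int_minus one_neq_zero neg_equal_0_iff_equal)

subsection \<open>The monomial basis of the skew polynomial ring\<close>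

definition content :: "'n list \<Rightarrow> ('n \<Rightarrow>\<^sub>0 nat)" where
  "content w = sum_list (map (\<lambda>i. Poly_Mapping.single i 1) w)"

lemma content_simps [simp]:
  "content [] = 0"
  "content (i # w) = Poly_Mapping.single i 1 + content w"
  "content (u @ v) = content u + content v"
  by (simp_all add: content_def)

lemma content_replicate [simp]: "content (replicate k i) = Poly_Mapping.single i k"
  by (induction k) (simp_all flip: single_add)

lemma content_map: "content (map \<sigma> w) = permute_mono \<sigma> (content w)"
  by (induction w) (simp_all add: permute_mono_add permute_mono_single)

lemma lookup_content: "expo (content w) i = count_list w i"
  by (induction w) (simp_all add: lookup_add lookup_single when_def)

lemma mset_eq_of_content:
  assumes "content w = content w'"
  shows "mset w = mset w'"
  by (rule multiset_eqI) (metis assms count_mset lookup_content)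

lemma total_degree_content: "total_degree (content w) = length w"
  by (induction w) (simp_all add: total_degree_add, simp_all add: total_degree_def lookup_single when_def)

lemma ex_word: "\<exists>w. content w = m"
proof (induction m rule: poly_mapping_single_induct)
  case 1
  show ?case by (rule exI[of _ "[]"]) simp
next
  case (2 v c)
  show ?case by (rule exI[of _ "replicate c v"]) simp
next
  case (3 p q)
  then show ?case by (metis content_simps(3))
qed

text \<open>Any word with the given content will do, sorted or not: \<open>inv_sign\<close> accounts
  for its order.\<close>

definition word :: "('n \<Rightarrow>\<^sub>0 nat) \<Rightarrow> 'n list" where
  "word m = (SOME w. content w = m)"

lemma content_word [simp]: "content (word m) = m"
  unfolding word_def using ex_word by (rule someI_ex)

lemma prod_list_signs:
  "prod_list (map (\<lambda>i. of_int (a i) * free_var (\<sigma> i)) w) =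
   Poly_Mapping.single (Free_Word (map \<sigma> w)) (sign_char a (content w))"
  by (induction w)
     (simp_all add: free_var_def mult_single plus_free_word_def sign_char_add sign_char_single
       sign_char_0 zero_free_word_def flip: single_of_int single_one)

lemma free_act_single_word:
  "free_act (\<sigma>, a) (Poly_Mapping.single (Free_Word w) c) =
   Poly_Mapping.single (Free_Word (map \<sigma> w)) (sign_char a (content w) * c)"
  by (simp add: free_act_single prod_list_signs mult_single mult.commute)

text \<open>The sign of sorting a word into increasing order, for the ordering of the variables by \<open>to_nat\<close>.\<close>

fun inv_sign :: "'n::finite list \<Rightarrow> 'k::field" where
  "inv_sign [] = 1"
| "inv_sign (i # w) = (-1) ^ length (filter (\<lambda>j. to_nat j < to_nat i) w) * inv_sign w"

lemma inv_sign_square [simp]: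
  fixes c :: "'k::field"
  shows "inv_sign w * inv_sign w = (1::'k)" "inv_sign w * (inv_sign w * c) = c"
proof -
  show 1: "inv_sign w * inv_sign w = (1::'k)"
    by (induction w) (simp_all add: algebra_simps power_mult_distrib[symmetric] flip: mult.assoc)
  then show "inv_sign w * (inv_sign w * c) = c" by (simp flip: mult.assoc)
qed

lemma inv_sign_nonzero: "inv_sign w \<noteq> (0::'k::field)"
  by (metis inv_sign_square(1) mult_zero_left zero_neq_one)

text \<open>Exchanging adjacent distinct letters changes the number of inversions by exactly
  one.\<close>

lemma inv_sign_swap:
  assumes "i \<noteq> j"
  shows "inv_sign (u @ i # j # v) = (- inv_sign (u @ j # i # v) :: 'k::field)"
proof (induction u)
  case Nil
  have "to_nat i \<noteq> to_nat j" using assms by simp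
  then show ?case by (cases "to_nat i < to_nat j") (auto simp: mult.left_commute)
qed simp

text \<open>Two equal letters at the end add zero or two inversions for each earlier letter. With a
  single variable there are no inversions.\<close>

lemma inv_sign_append_replicate:
  assumes "q = 2 \<or> CARD('n::finite) = 1"
  shows "inv_sign (w @ replicate q (i::'n)) = (inv_sign w :: 'k::field)"
  using assms
proof
  assume "q = 2"
  then show ?thesis by (induction w) (simp_all add: numeral_2_eq_2 power_add)
next
  assume "CARD('n) = 1"
  then have "j = k" for j k :: 'n by (metis card_1_singletonE UNIV_I singletonD)
  then have "inv_sign u = (1::'k)" for u :: "'n list"
  proof (induction u)
    case (Cons j u)
    have "filter (\<lambda>k. to_nat k < to_nat j) u = []"
      using \<open>\<And>j k. j = k\<close> by (auto simp: filter_empty_conv) (metis less_irrefl)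
    with Cons show ?case by simp
  qed simp
  then show ?thesis by simp
qed

section \<open>Linear comparison of the skew ring with the commutative ring\<close>

definition commutative_image :: "('n::finite, 'k::field) free_algebra \<Rightarrow> ('n, 'k) comm_poly" where
  "commutative_image f = (\<Sum>w\<in>Poly_Mapping.keys f.
     Poly_Mapping.single (content (letters w)) (inv_sign (letters w) * Poly_Mapping.lookup f w))"

lemma commutative_image_single:
  "commutative_image (Poly_Mapping.single w c) =
   Poly_Mapping.single (content (letters w)) (inv_sign (letters w) * c)"
  by (cases "c = 0") (simp_all add: commutative_image_def)

lemma commutative_image_0 [simp]: "commutative_image 0 = 0"
  by (simp add: commutative_image_def)

lemma commutative_image_add: "commutative_image (f + g) = commutative_image f + commutative_image g"
  unfolding commutative_image_def by (rule setsum_keys_plus_distrib) (auto simp: single_add distrib_left)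

lemma commutative_image_diff: "commutative_image (f - g) = commutative_image f - commutative_image g"
  using commutative_image_add[of "f - g" g] by (simp add: algebra_simps)

text \<open>By linearity \<open>f\<close> and \<open>g\<close> may be taken to be single words. The
  two resulting words have the same content and opposite signs.\<close>

lemma commutative_image_relation:
  assumes "i \<noteq> j"
  shows "commutative_image (f * (free_var i * free_var j + free_var j * free_var i) * g) = 0"
proof (induction f rule: poly_mapping_single_induct)
  case 1
  show ?case by simp
next
  case (2 u c)
  show ?case
  proof (induction g rule: poly_mapping_single_induct)
    case 1
    show ?case by simp
  next
    case (2 v d)
    show ?case
      using inv_sign_swap[OF assms, of "letters u" "letters v", where 'k = 'b]
      by (simp add: free_var_def distrib_left distrib_right mult_single commutative_image_add
          commutative_image_single plus_free_word_def ac_simps flip: single_add)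
  next
    case (3 p q)
    then show ?case by (simp only: distrib_left commutative_image_add add_0_left)
  qed
next
  case (3 p q)
  then show ?case by (simp only: distrib_right commutative_image_add add_0_left)
qed

lemma commutative_image_skew_ideal:
  assumes "f \<in> skew_ideal"
  shows "commutative_image f = 0"
proof -
  have "commutative_image f \<in> finite_sums {0}"
    using assms unfolding skew_ideal_def
    by (rule finite_sums_hom) (auto simp: commutative_image_add commutative_image_relation)
  moreover have "sum_list xs = 0" if "set xs \<subseteq> {0}" for xs :: "('a, 'b) comm_poly list"
    using that by (induction xs) auto
  ultimately show ?thesis by (auto simp: finite_sums_def)
qed

text \<open>Coordinates in the basis of sorted monomials, recorded as a commutative polynomial. The
  map is additive but not multiplicative in general.\<close>

definition skew_coeffs :: "('n::finite, 'k::field) skew_poly \<Rightarrow> ('n, 'k) comm_poly" where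
  "skew_coeffs f = commutative_image (rep_skew f)"

lemma skew_coeffs_mk_skew: "skew_coeffs (mk_skew f) = commutative_image f"
proof -
  have "rep_skew (mk_skew f) - f \<in> skew_ideal"
    by (rule Quotient3_rep_abs[OF Quotient3_skew_poly]) (simp add: skew_ideal_0)
  then have "commutative_image (rep_skew (mk_skew f) - f) = 0" by (rule commutative_image_skew_ideal)
  then show ?thesis by (simp add: skew_coeffs_def commutative_image_diff)
qed

lemma mk_skew_add: "mk_skew (f + g) = mk_skew f + mk_skew g"
  by (simp add: plus_skew_poly.abs_eq)

lemma mk_skew_mult: "mk_skew (f * g) = mk_skew f * mk_skew g"
  by (simp add: times_skew_poly.abs_eq)

lemma mk_skew_surj: "\<exists>f. x = mk_skew f"
  by (metis Quotient3_abs_rep[OF Quotient3_skew_poly])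

lemma skew_coeffs_add: "skew_coeffs (x + y) = skew_coeffs x + skew_coeffs y"
proof -
  obtain f g where "x = mk_skew f" "y = mk_skew g" using mk_skew_surj by metis
  then show ?thesis by (simp add: skew_coeffs_mk_skew commutative_image_add flip: mk_skew_add)
qed

text \<open>The factor \<open>inv_sign w\<close> compensates for the order of the letters, so the
  class in the skew ring depends only on their multiset, as \<open>mk_skew_signed_word_mset\<close>
  shows.\<close>

definition signed_word :: "'n::finite list \<Rightarrow> 'k::field \<Rightarrow> ('n, 'k) free_algebra" where
  "signed_word w c = Poly_Mapping.single (Free_Word w) (inv_sign w * c)"

text \<open>For distinct letters the two signs are opposite, so the difference is a multiple of a
  defining relation.\<close>

lemma mk_skew_swap: "mk_skew (signed_word (i # j # w) c) = mk_skew (signed_word (j # i # w) c)"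
proof (cases "i = j")
  case False
  have "signed_word (i # j # w) c - signed_word (j # i # w) c =
      1 * (free_var i * free_var j + free_var j * free_var i) *
      Poly_Mapping.single (Free_Word w) (inv_sign (i # j # w) * c)"
    using inv_sign_swap[OF False, of "[]" w, where 'k = 'b]
    by (simp add: signed_word_def free_var_def distrib_right mult_single plus_free_word_def single_uminus)
  also have "\<dots> \<in> skew_ideal"
    unfolding skew_ideal_def using False by (intro finite_sums_base) blast
  finally show ?thesis by (simp add: skew_poly.abs_eq_iff)
qed simp

text \<open>The sign contributed by a new first letter counts the smaller letters after it, hence
  depends only on their multiset.\<close>

lemma mk_skew_signed_word_Cons:
  assumes "mset w = mset w'" "\<And>c::'k::field. mk_skew (signed_word w c) = mk_skew (signed_word w' c)"
  shows "mk_skew (signed_word (i # w) (c::'k)) = mk_skew (signed_word (i # w') c)"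
proof -
  have Cons: "signed_word (i # u) c =
      free_var i * signed_word u ((-1::'k) ^ size (filter_mset (\<lambda>j. to_nat j < to_nat i) (mset u)) * c)" for u
    by (simp add: signed_word_def free_var_def mult_single plus_free_word_def mult_ac
        flip: size_mset)
  show ?thesis by (simp only: Cons mk_skew_mult assms)
qed

lemma mk_skew_signed_word_move:
  "mk_skew (signed_word (u @ i # v) c) = mk_skew (signed_word (i # u @ v) c)"
proof (induction u arbitrary: c)
  case (Cons j u)
  have "mk_skew (signed_word (j # u @ i # v) c) = mk_skew (signed_word (j # i # u @ v) c)"
    by (rule mk_skew_signed_word_Cons) (simp_all add: Cons.IH)
  then show ?case by (simp add: mk_skew_swap[of j i])
qed simp

text \<open>Find the first letter of \<open>w\<close> inside \<open>w'\<close>, move it to the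
  front, and compare the remaining words.\<close>

lemma mk_skew_signed_word_mset:
  "mset w = mset w' \<Longrightarrow> mk_skew (signed_word w c) = mk_skew (signed_word w' c)"
proof (induction w arbitrary: w' c)
  case (Cons i w)
  then have "i \<in> set w'" by (metis list.set_intros(1) mset_eq_setD)
  then obtain u v where w': "w' = u @ i # v" by (meson split_list)
  then have "mset w = mset (u @ v)" using Cons.prems by simp
  then have "mk_skew (signed_word (i # w) c) = mk_skew (signed_word (i # u @ v) c)"
    using Cons.IH by (intro mk_skew_signed_word_Cons) auto
  then show ?case by (simp add: w' mk_skew_signed_word_move)
qed simp

section \<open>Normal forms and the monomial basis\<close>

definition normal_form :: "('n::finite, 'k::field) comm_poly \<Rightarrow> ('n, 'k) free_algebra" where
  "normal_form p = (\<Sum>m\<in>Poly_Mapping.keys p. signed_word (word m) (Poly_Mapping.lookup p m))"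

lemma signed_word_0 [simp]: "signed_word w 0 = 0"
  by (simp add: signed_word_def)

lemma commutative_image_signed_word: "commutative_image (signed_word w c) = Poly_Mapping.single (content w) c"
  by (simp add: signed_word_def commutative_image_single)

lemma normal_form_0 [simp]: "normal_form 0 = 0"
  by (simp add: normal_form_def)

lemma normal_form_single: "normal_form (Poly_Mapping.single m c) = signed_word (word m) c"
  by (cases "c = 0") (simp_all add: normal_form_def)

lemma normal_form_add: "normal_form (p + r) = normal_form p + normal_form r"
  unfolding normal_form_def
  by (rule setsum_keys_plus_distrib) (auto simp: signed_word_def single_add distrib_left)

lemma commutative_image_normal_form: "commutative_image (normal_form p) = p"
  by (induction p rule: poly_mapping_single_induct)
     (simp_all add: normal_form_single commutative_image_signed_word normal_form_add commutative_image_add)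

lemma mk_skew_normal_form: "mk_skew (normal_form (commutative_image f)) = mk_skew f"
proof (induction f rule: poly_mapping_single_induct)
  case (2 w c)
  have "signed_word (letters w) (inv_sign (letters w) * c) = Poly_Mapping.single w c"
    by (simp add: signed_word_def)
  moreover have "mset (word (content (letters w))) = mset (letters w)"
    by (rule mset_eq_of_content) simp
  ultimately show ?case
    by (metis commutative_image_single normal_form_single mk_skew_signed_word_mset)
qed (simp_all add: normal_form_add commutative_image_add mk_skew_add)

lemma normal_form_homogeneous:
  assumes "p \<in> comm_homogeneous d"
  shows "normal_form p \<in> free_homogeneous d"
proof -
  have "length (letters w) = d" if w: "w \<in> Poly_Mapping.keys (normal_form p)" for w
  proof -
    obtain m where m: "m \<in> Poly_Mapping.keys p"
      "w \<in> Poly_Mapping.keys (signed_word (word m) (Poly_Mapping.lookup p m))"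
      using subsetD[OF Poly_Mapping.keys_sum w[unfolded normal_form_def]] by blast
    then have "w = Free_Word (word m)" by (simp add: signed_word_def split: if_splits)
    with m(1) assms show ?thesis
      by (simp add: comm_homogeneous_iff flip: total_degree_content)
  qed
  then show ?thesis by (simp add: free_homogeneous_def)
qed

text \<open>Injectivity expresses that the monomials span the skew ring, surjectivity that they are
  linearly independent.\<close>

lemma skew_coeffs_bij: "bij (skew_coeffs :: ('n::finite, 'k::field) skew_poly \<Rightarrow> _)"
proof (rule bijI)
  show "inj (skew_coeffs :: ('n, 'k) skew_poly \<Rightarrow> _)"
  proof (rule injI)
    fix x y :: "('n, 'k) skew_poly"
    assume "skew_coeffs x = skew_coeffs y"
    moreover obtain f g where "x = mk_skew f" "y = mk_skew g" using mk_skew_surj by metis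
    ultimately show "x = y" by (metis skew_coeffs_mk_skew mk_skew_normal_form)
  qed
  show "surj (skew_coeffs :: ('n, 'k) skew_poly \<Rightarrow> _)"
    by (rule surjI[of _ "\<lambda>p. mk_skew (normal_form p)"])
       (simp add: skew_coeffs_mk_skew commutative_image_normal_form)
qed

lemma skew_homogeneous_iff: "x \<in> skew_homogeneous d \<longleftrightarrow> skew_coeffs x \<in> comm_homogeneous d"
proof
  assume "x \<in> skew_homogeneous d"
  then obtain f where x: "x = mk_skew f" and f: "f \<in> free_homogeneous d"
    by (auto simp: skew_homogeneous_def)
  have "commutative_image f \<in> comm_homogeneous d"
    unfolding commutative_image_def using f
    by (intro comm_homogeneous_sum comm_homogeneous_single) (auto simp: total_degree_content free_homogeneous_def)
  then show "skew_coeffs x \<in> comm_homogeneous d" by (simp add: x skew_coeffs_mk_skew)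
next
  assume "skew_coeffs x \<in> comm_homogeneous d"
  then have "normal_form (skew_coeffs x) \<in> free_homogeneous d" by (rule normal_form_homogeneous)
  moreover obtain f where "x = mk_skew f" using mk_skew_surj by metis
  then have "x = mk_skew (normal_form (skew_coeffs x))"
    by (simp add: skew_coeffs_mk_skew mk_skew_normal_form)
  ultimately show "x \<in> skew_homogeneous d" by (auto simp: skew_homogeneous_def)
qed

section \<open>Reordering signs of permuted skew monomials\<close>

definition twist :: "('n::finite \<Rightarrow> 'n) \<Rightarrow> ('n \<Rightarrow>\<^sub>0 nat) \<Rightarrow> 'k::field" where
  "twist \<sigma> m = inv_sign (map \<sigma> (word m)) * inv_sign (word m)"

text \<open>Independence of the chosen word needs no counting of inversions: words with equal
  content have equal signed classes, and the action is well defined on classes. Comparing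
  coefficients of the images gives the claim.\<close>

lemma twist_content:
  assumes "bij \<sigma>"
  shows "twist \<sigma> (content w) = (inv_sign (map \<sigma> w) * inv_sign w :: 'k::field)"
proof -
  have 1: "(\<sigma>, \<lambda>_. 1) \<in> carrier signed_perms" using assms by (simp add: signed_perms_def)
  have image: "skew_coeffs (skew_act (\<sigma>, \<lambda>_. 1) (mk_skew (signed_word u (1::'k)))) =
      Poly_Mapping.single (permute_mono \<sigma> (content u)) (inv_sign (map \<sigma> u) * inv_sign u)" for u
    by (simp add: skew_act_mk_skew[OF 1] skew_coeffs_mk_skew signed_word_def free_act_single_word
        commutative_image_single content_map sign_char_def del: free_act.simps)
  have "mset (word (content w)) = mset w" by (rule mset_eq_of_content) simp
  from mk_skew_signed_word_mset[OF this, of "1::'k"] image[of "word (content w)"] image[of w]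
  show ?thesis by (metis twist_def content_word lookup_single_eq)
qed

lemma skew_coeffs_act:
  assumes "(\<sigma>, a) \<in> carrier signed_perms"
  shows "skew_coeffs (skew_act (\<sigma>, a) x) = monomial_act \<sigma> (\<lambda>m. sign_char a m * twist \<sigma> m) (skew_coeffs x)"
proof -
  have \<sigma>: "bij \<sigma>" using assms by (simp add: signed_perms_def)
  obtain f where x: "x = mk_skew f" using mk_skew_surj by metis
  have "commutative_image (free_act (\<sigma>, a) f) =
      monomial_act \<sigma> (\<lambda>m. sign_char a m * twist \<sigma> m) (commutative_image f)"
  proof (induction f rule: poly_mapping_single_induct)
    case (2 w c)
    obtain u where w: "w = Free_Word u" by (cases w)
    show ?case
      by (simp add: w free_act_single_word commutative_image_single monomial_act_single content_map
          twist_content[OF \<sigma>] mult_ac del: free_act.simps)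
  qed (simp_all only: free_act_0 free_act_add commutative_image_0 commutative_image_add monomial_act_0 monomial_act_add)
  then show ?thesis by (simp add: x skew_act_mk_skew[OF assms] skew_coeffs_mk_skew)
qed

text \<open>Appending \<open>q\<close> copies of \<open>i\<close> to a word does not change
  \<open>inv_sign\<close>, so right multiplication by this power involves no sign.\<close>

lemma skew_coeffs_mult:
  fixes x y :: "('n::finite, 'k::field) skew_poly"
  assumes q: "q = 2 \<or> CARD('n) = 1"
    and y: "skew_coeffs y = Poly_Mapping.single (Poly_Mapping.single i q) 1"
  shows "skew_coeffs (x * y) = skew_coeffs x * skew_coeffs y"
proof -
  let ?y = "Poly_Mapping.single (Free_Word (replicate q i)) 1 :: ('n, 'k) free_algebra"
  have "inv_sign (replicate q i) = (1::'k)"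
    using inv_sign_append_replicate[OF q, of "[]" i, where 'k = 'k] by simp
  then have "skew_coeffs (mk_skew ?y) = skew_coeffs y"
    by (simp add: y skew_coeffs_mk_skew commutative_image_single)
  \<comment> \<open>Injectivity of the coordinates identifies \<open>y\<close> as the
    \<open>q\<close>-th power of the variable \<open>i\<close>.\<close>
  then have y': "y = mk_skew ?y"
    using bij_is_inj[OF skew_coeffs_bij] by (auto dest: injD)
  obtain f where x: "x = mk_skew f" using mk_skew_surj by metis
  have "commutative_image (f * ?y) = commutative_image f * Poly_Mapping.single (Poly_Mapping.single i q) 1"
    by (induction f rule: poly_mapping_single_induct)
       (simp_all add: distrib_right mult_single commutative_image_single commutative_image_add letters_add
         inv_sign_append_replicate[OF q])
  then show ?thesis
    by (simp only: y) (simp only: x y' skew_coeffs_mk_skew flip: mk_skew_mult)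
qed

lemma skew_coeffs_1: "skew_coeffs 1 = 1"
  by (simp add: one_skew_poly.abs_eq skew_coeffs_mk_skew commutative_image_single zero_free_word_def flip: single_one)

section \<open>The degree bounds for both rings\<close>

context
  fixes G :: "(('n::finite \<Rightarrow> 'n) \<times> ('n \<Rightarrow> int)) set" and q :: nat
  assumes G: "G \<subseteq> carrier signed_perms"
    and q: "q = 2 \<or> q = 1 \<and> CARD('n) = 1 \<and> (\<forall>(\<sigma>, a)\<in>G. \<forall>i. of_int (a i) = (1::'k::field))"
begin

lemma G_facts:
  assumes "(\<sigma>, a) \<in> G"
  shows "bij \<sigma>" "a i \<in> {1, -1}" "sign_char a (m + Poly_Mapping.single i q) = (sign_char a m :: 'k)"
proof -
  show "bij \<sigma>" and a: "a i \<in> {1, -1}"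
    using assms G by (auto simp: signed_perms_def)
  have "of_int (a i) ^ q = (1::'k)"
    using q
  proof
    assume "q = 2"
    then show ?thesis using a by auto
  qed (use assms in auto)
  then show "sign_char a (m + Poly_Mapping.single i q) = (sign_char a m :: 'k)"
    by (simp add: sign_char_add sign_char_single)
qed

lemma sign_char_G_nonzero: "(\<sigma>, a) \<in> G \<Longrightarrow> sign_char a m \<noteq> 0"
  by (rule sign_char_nonzero) (rule G_facts)

lemma q_pos: "0 < q"
  using q by auto

text \<open>Evaluate the sign on \<open>word m @ replicate q i\<close>: the appended block stays
  constant under \<open>\<sigma>\<close> and affects neither inversion sign.\<close>

lemma twist_add:
  assumes "bij \<sigma>"
  shows "twist \<sigma> (m + Poly_Mapping.single (i::'n) q) = (twist \<sigma> m :: 'k)"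
proof -
  have q': "q = 2 \<or> CARD('n) = 1" using q by blast
  show ?thesis
    using twist_content[OF assms, of "word m @ replicate q i", where 'k = 'k]
    by (simp add: inv_sign_append_replicate[OF q'] twist_def)
qed

lemma comm_bound:
  assumes D: "(\<Sum>j<CARD('n). q * Suc j - 1) \<le> D" "q * CARD('n) \<le> D"
  shows "max_gen_degree (comm_invariants G :: nat \<Rightarrow> ('n, 'k) comm_poly set) \<le> enat D"
proof -
  interpret monomial_action "(\<lambda>(\<sigma>, a). (\<sigma>, sign_char a :: _ \<Rightarrow> 'k)) ` G" q
    by standard (auto simp: q_pos sign_char_0 G_facts dest: sign_char_G_nonzero)
  have "f \<in> comm_invariants G d \<longleftrightarrow> id f \<in> invs d" for f d
    by (auto simp: comm_invariants_def invs_def simp flip: comm_act_eq)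
  then show ?thesis by (intro max_gen_degree_le[of id] D) auto
qed

lemma skew_bound:
  assumes D: "(\<Sum>j<CARD('n). q * Suc j - 1) \<le> D" "q * CARD('n) \<le> D"
  shows "max_gen_degree (skew_invariants G :: nat \<Rightarrow> ('n, 'k) skew_poly set) \<le> enat D"
proof -
  have q': "q = 2 \<or> CARD('n) = 1" using q by blast
  let ?e = "\<lambda>\<sigma> a m. sign_char a m * twist \<sigma> m :: 'k"
  interpret monomial_action "(\<lambda>(\<sigma>, a). (\<sigma>, ?e \<sigma> a)) ` G" q
  proof
    have "twist \<sigma> 0 = (1::'k)" if "bij \<sigma>" for \<sigma> :: "'n \<Rightarrow> 'n"
      using twist_content[OF that, of "[]", where 'k = 'k] by simp
    then show "(\<sigma>, e) \<in> (\<lambda>(\<sigma>, a). (\<sigma>, ?e \<sigma> a)) ` G \<Longrightarrow> e 0 = 1" for \<sigma> e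
      by (auto simp: sign_char_0 G_facts)
    show "(\<sigma>, e) \<in> (\<lambda>(\<sigma>, a). (\<sigma>, ?e \<sigma> a)) ` G \<Longrightarrow> e m \<noteq> 0" for \<sigma> e m
      by (auto simp: twist_def inv_sign_nonzero dest: sign_char_G_nonzero)
  qed (auto simp: q_pos G_facts twist_add)
  have "skew_act (\<sigma>, a) f = f \<longleftrightarrow> monomial_act \<sigma> (?e \<sigma> a) (skew_coeffs f) = skew_coeffs f"
    if "(\<sigma>, a) \<in> G" for \<sigma> a and f :: "('n, 'k) skew_poly"
    by (simp add: inj_eq[OF bij_is_inj[OF skew_coeffs_bij]] flip: skew_coeffs_act[OF subsetD[OF G that]])
  \<comment> \<open>Invariance passes to coordinates because \<open>skew_coeffs\<close> is injective
    and intertwines the actions.\<close>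
  then have "f \<in> skew_invariants G d \<longleftrightarrow> skew_coeffs f \<in> invs d" for f d
    by (auto simp: skew_invariants_def invs_def skew_homogeneous_iff)
  with q' show ?thesis
    by (intro max_gen_degree_le[of skew_coeffs] D skew_coeffs_bij skew_coeffs_add skew_coeffs_1
        skew_coeffs_mult) assumption+
qed

end

theorem theorem2p6:
  fixes G :: "(('n::finite \<Rightarrow> 'n) \<times> ('n \<Rightarrow> int)) set"
  assumes "subgroup G signed_perms"
    and "CARD('n) = 1 \<Longrightarrow> CHAR('k) = 2 \<or> G = {\<one>\<^bsub>signed_perms\<^esub>}"
  shows "max_gen_degree (skew_invariants G :: nat \<Rightarrow> ('n, 'k::field) skew_poly set) \<le> enat (CARD('n) ^ 2)
       \<and> max_gen_degree (comm_invariants G :: nat \<Rightarrow> ('n, 'k) comm_poly set) \<le> enat (CARD('n) ^ 2)"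
proof -
  have G: "G \<subseteq> carrier signed_perms" using assms(1) by (rule subgroup.subset)
  \<comment> \<open>With one variable, \<open>q = 2\<close> would violate
    \<open>q * CARD('n) \<le> CARD('n)\<^sup>2\<close>.\<close>
  define q :: nat where "q = (if CARD('n) = 1 then 1 else 2)"
  \<comment> \<open>In one variable the second assumption makes all signs equal to \<open>1\<close>
    in the field, as \<open>q = 1\<close> requires.\<close>
  have "of_int (a i) = (1::'k)" if "CARD('n) = 1" "(\<sigma>, a) \<in> G" for \<sigma> a i
    using assms(2)[OF that(1)]
  proof
    assume "CHAR('k) = 2"
    then have "(-1::'k) = 1" by (rule uminus_CHAR_2)
    moreover have "a i \<in> {1, -1}" using that(2) G by (auto simp: signed_perms_def)
    ultimately show ?thesis by auto
  qed (use that(2) in \<open>simp add: signed_perms_def\<close>)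
  then have q: "q = 2 \<or> q = 1 \<and> CARD('n) = 1 \<and> (\<forall>(\<sigma>, a)\<in>G. \<forall>i. of_int (a i) = (1::'k))"
    by (auto simp: q_def)
  \<comment> \<open>The sum of the first \<open>n\<close> odd numbers. For \<open>q = 1\<close>
    there is one variable and the corresponding sum is \<open>0\<close>.\<close>
  have "(\<Sum>j<n. 2 * Suc j - 1) = n\<^sup>2" for n
    by (induction n) (simp_all add: power2_eq_square)
  then have "(\<Sum>j<CARD('n). q * Suc j - 1) \<le> CARD('n)\<^sup>2"
    by (simp add: q_def)
  moreover have "q \<le> CARD('n)"
    using zero_less_card_finite[where 'a = 'n] unfolding q_def by (split if_split) arith
  then have "q * CARD('n) \<le> CARD('n)\<^sup>2"
    unfolding power2_eq_square by (rule mult_right_mono) simp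
  ultimately show ?thesis
    using skew_bound[OF G q] comm_bound[OF G q] by blast
qed

end
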